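(* For any $n\ge1$, $$A_n(q,t)=\sum_{(\alpha,f)\in\mathtt{Code}_n}q^{\mathrm{inv}(\alpha)}t^{\mathrm{ind}(\alpha,f)}=\sum_{(\alpha,f)\in\mathtt{Code}_n}q^{\mathrm{maj}(\alpha)}t^{\mathrm{ind}(\alpha,f)},$$ where $\mathrm{inv}(\alpha)$ and $\mathrm{maj}(\alpha)$ are the inversion number and the major index of $\alpha$ as a word over $\{0<1<2<\cdots\}$.
   Context: For a word $w=w_1\cdots w_n$ over a totally ordered set: $\mathrm{DES}(w)=\{i\in[n-1]:w_i>w_{i+1}\}$, $\mathrm{maj}(w)=\sum_{i\in\mathrm{DES}(w)}i$, $\mathrm{inv}(w)=|\{(i,j):1\le i<j\le n,\ w_i>w_j\}|$. For $\sigma\in\mathfrak{S}_n$, $\mathrm{exc}(\sigma)=|\{i\in[n-1]:\sigma_i>i\}|$. The $q$-Eulerian polynomial is $$A_n(q,t)=\sum_{\sigma\in\mathfrak{S}_n}q^{\mathrm{maj}(\sigma)-\mathrm{exc}(\sigma)}t^{\mathrm{exc}(\sigma)}.$$ A Stembridge code of length $n$ is a pair $(\alpha,f)$ where $\alpha=\alpha_1\cdots\alpha_n$ is a sequence over $\{0,1,2,\dots\}$ such that, with $m(\alpha)$ the maximum number appearing in $\alpha$, each $k\in\{1,\dots,m(\alpha)\}$ occurs at least twice in $\alpha$; and for each such $k$ exactly one occurrence of $k$ other than the first is marked, with $f(k)$ the number of occurrences of $k$ to the left of the marked one (so $f:\{1,\dots,m(\alpha)\}\to\mathbb{Z}$ is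 any function with $1\le f(k)\le(\text{number of occurrences of }k\text{ in }\alpha)-1$). The letter $0$ may occur any number of times. The index is $\mathrm{ind}(\alpha,f)=\sum_{k=1}^{m(\alpha)}f(k)$. $\mathtt{Code}_n$ is the set of all Stembridge codes of length $n$. *)

theory Defs
  imports
    "HOL-Library.FuncSet"
    "HOL-Combinatorics.Permutations"
    "HOL-Computational_Algebra.Polynomial"
begin

text \<open>Positions in a word are numbered from 1, so the \<open>i\<close>-th letter of \<open>w\<close> is \<open>w ! (i - 1)\<close>.\<close>

definition DES :: "'a::linorder list \<Rightarrow> nat set" where
  "DES w = {i. 1 \<le> i \<and> i < length w \<and> w ! (i - 1) > w ! i}"

definition maj :: "'a::linorder list \<Rightarrow> nat" where
  "maj w = (\<Sum>i\<in>DES w. i)"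

definition inv_num :: "'a::linorder list \<Rightarrow> nat" where
  "inv_num w = card {(i, j). 1 \<le> i \<and> i < j \<and> j \<le> length w \<and> w ! (i - 1) > w ! (j - 1)}"

definition perm_word :: "nat \<Rightarrow> (nat \<Rightarrow> nat) \<Rightarrow> nat list" where
  "perm_word n \<sigma> = map \<sigma> [1..<Suc n]"

definition exc :: "nat \<Rightarrow> (nat \<Rightarrow> nat) \<Rightarrow> nat" where
  "exc n \<sigma> = card {i\<in>{1..n - 1}. \<sigma> i > i}"

lemma exc_le_maj:
  assumes "\<sigma> permutes {1..n}"
  shows "exc n \<sigma> \<le> maj (perm_word n \<sigma>)"
proof -
  define D where "D = DES (perm_word n \<sigma>)"
  define d where "d = Max (insert 0 D)"
  have D: "D = {i. 1 \<le> i \<and> i < n \<and> \<sigma> i > \<sigma> (Suc i)}"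
    unfolding D_def DES_def perm_word_def by (auto simp del: upt_Suc)
  have fin: "finite D"
    by (rule finite_subset[of _ "{..n}"]) (auto simp: D)
  have asc: "\<sigma> i < \<sigma> (Suc i)" if "d < i" "i < n" for i
  proof -
    have "i \<notin> D" using that(1) fin unfolding d_def by (metis Max_ge finite_insert insertCI not_le)
    moreover have "\<sigma> i \<noteq> \<sigma> (Suc i)"
      using permutes_inj[OF assms] by (metis injD n_not_Suc_n)
    ultimately show ?thesis using that by (auto simp: D)
  qed
  have le: "\<sigma> i \<le> i" if "d < i" "i \<le> n" for i
    using that(2,1)
  proof (induction i rule: inc_induct)
    case base
    have "\<sigma> n \<in> {1..n}" using base by (subst permutes_in_image[OF assms]) auto
    then show ?case by simp
  next
    case (step i)
    then show ?case using asc[of i] by simp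
  qed
  have "{i\<in>{1..n - 1}. \<sigma> i > i} \<subseteq> {1..d}"
  proof
    fix i assume i: "i \<in> {i\<in>{1..n - 1}. \<sigma> i > i}"
    then have "i \<le> n" by auto
    then have "\<not> d < i" using i le[of i] by auto
    then show "i \<in> {1..d}" using i by auto
  qed
  then have "exc n \<sigma> \<le> d"
    unfolding exc_def using card_mono[of "{1..d}"] by fastforce
  also have "d \<le> sum id D"
  proof (cases "d = 0")
    case False
    then have "d \<in> D" using Max_in[of "insert 0 D"] fin by (auto simp: d_def)
    then show ?thesis using member_le_sum[of d D id] fin by auto
  qed simp
  finally show ?thesis by (simp add: maj_def D_def)
qed

text \<open>
  Polynomials in \<open>q\<close> and \<open>t\<close> are elements of \<open>\<int>[q][t]\<close>, with \<open>t\<close> the outer variable;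
  \<open>qt a b\<close> is the monomial \<open>q\<^sup>a t\<^sup>b\<close>.
\<close>

definition qt :: "nat \<Rightarrow> nat \<Rightarrow> int poly poly" where
  "qt a b = monom (monom 1 a) b"

text \<open>By \<open>exc_le_maj\<close> the subtraction on \<open>nat\<close> in the exponent never truncates.\<close>

definition q_Eulerian :: "nat \<Rightarrow> int poly poly" where
  "q_Eulerian n =
     (\<Sum>\<sigma> | \<sigma> permutes {1..n}. qt (maj (perm_word n \<sigma>) - exc n \<sigma>) (exc n \<sigma>))"

text \<open>The added 0 gives the empty sequence maximum 0 and has no effect on other sequences.\<close>

definition max_letter :: "nat list \<Rightarrow> nat" where
  "max_letter \<alpha> = Max (insert 0 (set \<alpha>))"

text \<open>
  The marking is recorded by \<open>f\<close> alone, as a function with domain \<open>{1..max_letter \<alpha>}\<close>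
  (extensional, that is \<open>undefined\<close> elsewhere, so that each code is counted once).
\<close>

definition Code :: "nat \<Rightarrow> (nat list \<times> (nat \<Rightarrow> nat)) set" where
  "Code n = {(\<alpha>, f).
     length \<alpha> = n \<and>
     (\<forall>k\<in>{1..max_letter \<alpha>}. count_list \<alpha> k \<ge> 2) \<and>
     f \<in> (\<Pi>\<^sub>E k\<in>{1..max_letter \<alpha>}. {1..count_list \<alpha> k - 1})}"

definition ind :: "nat list \<Rightarrow> (nat \<Rightarrow> nat) \<Rightarrow> nat" where
  "ind \<alpha> f = (\<Sum>k = 1..max_letter \<alpha>. f k)"

lemma finite_Code: "finite (Code n)"
proof -
  let ?L = "{\<alpha>. set \<alpha> \<subseteq> {..n} \<and> length \<alpha> = n}"
  have "Code n \<subseteq> (SIGMA \<alpha>:?L. \<Pi>\<^sub>E k\<in>{1..max_letter \<alpha>}. {1..count_list \<alpha> k - 1})"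
  proof (rule subrelI)
    fix \<alpha> f assume "(\<alpha>, f) \<in> Code n"
    then have len: "length \<alpha> = n" and two: "\<forall>k\<in>{1..max_letter \<alpha>}. count_list \<alpha> k \<ge> 2"
      and f: "f \<in> (\<Pi>\<^sub>E k\<in>{1..max_letter \<alpha>}. {1..count_list \<alpha> k - 1})"
      by (auto simp: Code_def)
    have "{1..max_letter \<alpha>} \<subseteq> set \<alpha>"
      using two by (metis count_list_0_iff not_numeral_le_zero subsetI)
    then have "max_letter \<alpha> \<le> n"
      using card_mono[of "set \<alpha>" "{1..max_letter \<alpha>}"] card_length[of \<alpha>] len by simp
    moreover have "x \<le> max_letter \<alpha>" if "x \<in> set \<alpha>" for x
      using that unfolding max_letter_def by (intro Max_ge) auto
    ultimately have "\<alpha> \<in> ?L" using len by force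
    then show "(\<alpha>, f) \<in> (SIGMA \<alpha>:?L. \<Pi>\<^sub>E k\<in>{1..max_letter \<alpha>}. {1..count_list \<alpha> k - 1})"
      using f by blast
  qed
  moreover have "finite (SIGMA \<alpha>:?L. \<Pi>\<^sub>E k\<in>{1..max_letter \<alpha>}. {1..count_list \<alpha> k - 1})"
    by (intro finite_SigmaI finite_PiE finite_lists_length_eq) auto
  ultimately show ?thesis by (rule finite_subset)
qed

end

theory Submission
  imports Defs "HOL-Combinatorics.Multiset_Permutations"
    "HOL-Computational_Algebra.Formal_Power_Series"
begin

text \<open>
  Mark each excedance letter of \<open>\<sigma>\<close> by a bar and let barred letters precede unbarred ones. If
  \<open>DEX(\<sigma>)\<close> is the descent set of this word, then \<open>maj \<sigma> - exc \<sigma>\<close> is the sum of \<open>DEX(\<sigma>)\<close>.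
  So for the formula with \<open>maj\<close> it is enough to show, for every set \<open>S\<close> of positions,
  that the sum of \<open>t ^ exc \<sigma>\<close> over the \<open>\<sigma>\<close> with \<open>DEX(\<sigma>) \<subseteq> S\<close> equals the sum of
  \<open>t ^ ind(\<alpha>, f)\<close> over the codes with \<open>DES(\<alpha>) \<subseteq> S\<close>. The set \<open>S\<close> cuts the positions into blocks of sizes \<open>c\<close>.

  On the side of the codes \<open>\<alpha>\<close> is increasing in each block, and removing its largest letter gives
  a recursion in \<open>c\<close>, in generating function terms \<open>(1 - t) H(x) / (H(t x) - t H(x))\<close> with
  \<open>H(x) = \<Prod>\<^sub>a 1 / (1 - x\<^sub>a)\<close>.

  On the side of the permutations \<open>\<sigma>\<close> is recovered from the word which records for each value the
  block in which it occurs and whether it is an excedance letter. Hence the sum is a sum over words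
  of content \<open>c\<close> of products of weights that depend only on the order of a letter and of the block
  of its position and on whether this position is the first of its block. After adding a parameter \<open>s\<close> to all weights, the last block can be eliminated
  at the price of a substitution for \<open>s\<close>, as in the proof of MacMahon's Master Theorem by
  Schur complements, and by induction on the number of blocks the same generating function results.

  The formula with \<open>inv\<close> then follows from MacMahon's theorem on \<open>inv\<close> and \<open>maj\<close> for words of
  given content.
\<close>

section \<open>Barred descents and blocks of positions\<close>

lemma finite_DES: "finite (DES w)"
  by (rule finite_subset[of _ "{..length w}"]) (auto simp: DES_def)

lemma DES_subset: "DES w \<subseteq> {1..<length w}"
  by (auto simp: DES_def)

text \<open>For a permutation of \<open>{1..n}\<close>, adding \<open>n\<close> to the letters that
  are not excedance letters moves them above all barred letters, so the order of barred and unbarred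
  letters becomes the usual order of nat.\<close>

definition bar_word :: "nat \<Rightarrow> (nat \<Rightarrow> nat) \<Rightarrow> nat list" where
  "bar_word n \<sigma> = map (\<lambda>i. \<sigma> i + (if \<sigma> i > i then 0 else n)) [1..<Suc n]"

lemma length_bar_word [simp]: "length (bar_word n \<sigma>) = n"
  by (simp add: bar_word_def)

lemma sum_mult_diff_Suc:
  fixes e :: "nat \<Rightarrow> int"
  assumes "n \<ge> 1"
  shows "(\<Sum>i\<in>{1..<n}. int i * (e i - e (Suc i))) = (\<Sum>i\<in>{1..n}. e i) - int n * e n"
  using assms
proof (induction n rule: nat_induct_at_least)
  case (Suc n)
  then show ?case
    by (simp add: algebra_simps sum.atLeastLessThan_Suc)
qed simp

text \<open>Let \<open>e i\<close> be 1 if \<open>i\<close> is an excedance and 0 otherwise. If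
  \<open>e i = e (Suc i)\<close>, then \<open>i\<close> is in both descent sets or in neither. An
  excedance followed by a non-excedance gives a descent of \<open>\<sigma>\<close> only, the reverse
  a descent of the barred word only. So the two sums differ by the sum of
  \<open>i * (e i - e (Suc i))\<close>, which by summation by parts is
  \<open>exc n \<sigma>\<close>, as \<open>e n = 0\<close>.\<close>

lemma maj_eq_bar_word:
  assumes "\<sigma> permutes {1..n}"
  shows "maj (perm_word n \<sigma>) = \<Sum>(DES (bar_word n \<sigma>)) + exc n \<sigma>"
proof (cases "n \<ge> 1")
  case False
  then show ?thesis by (simp add: maj_def DES_def exc_def bar_word_def perm_word_def)
next
  case True
  let ?I = "{1..<n}"
  let ?D = "DES (perm_word n \<sigma>)" and ?E = "DES (bar_word n \<sigma>)"
  define e where "e i = (if \<sigma> i > i then 1 else 0 :: int)" for i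
  have D: "i \<in> ?D \<longleftrightarrow> \<sigma> i > \<sigma> (Suc i)" if "i \<in> ?I" for i
    using that unfolding DES_def perm_word_def by (auto simp del: upt_Suc)
  have range: "1 \<le> \<sigma> i" "\<sigma> i \<le> n" if "i \<in> {1..n}" for i
    using permutes_in_image[OF assms, of i] that by auto
  have ne: "\<sigma> i \<noteq> \<sigma> (Suc i)" for i
    using permutes_inj[OF assms] by (metis injD n_not_Suc_n)
  have E: "i \<in> ?E \<longleftrightarrow> \<sigma> i + (if \<sigma> i > i then 0 else n) >
      \<sigma> (Suc i) + (if \<sigma> (Suc i) > Suc i then 0 else n)" if "i \<in> ?I" for i
    using that unfolding DES_def bar_word_def by (auto simp del: upt_Suc)
  have diff: "(if i \<in> ?D then int i else 0) - (if i \<in> ?E then int i else 0) =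
      int i * (e i - e (Suc i))" if i: "i \<in> ?I" for i
  proof -
    have r: "1 \<le> \<sigma> i" "\<sigma> i \<le> n" "1 \<le> \<sigma> (Suc i)" "\<sigma> (Suc i) \<le> n"
      using range[of i] range[of "Suc i"] i by auto
    show ?thesis
    proof (cases "\<sigma> i > i"; cases "\<sigma> (Suc i) > Suc i")
      assume "\<sigma> i > i" "\<not> \<sigma> (Suc i) > Suc i"
      then have "i \<in> ?D" "i \<notin> ?E" using r ne[of i] unfolding D[OF i] E[OF i] by auto
      then show ?thesis using \<open>\<sigma> i > i\<close> \<open>\<not> \<sigma> (Suc i) > Suc i\<close> by (simp add: e_def)
    next
      assume "\<not> \<sigma> i > i" "\<sigma> (Suc i) > Suc i"
      then have "i \<notin> ?D" "i \<in> ?E" using r unfolding D[OF i] E[OF i] by auto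
      then show ?thesis using \<open>\<not> \<sigma> i > i\<close> \<open>\<sigma> (Suc i) > Suc i\<close> by (simp add: e_def)
    next
      assume c: "\<sigma> i > i" "\<sigma> (Suc i) > Suc i"
      then have "i \<in> ?D \<longleftrightarrow> i \<in> ?E" unfolding D[OF i] E[OF i] by auto
      then show ?thesis using c by (simp add: e_def)
    next
      assume c: "\<not> \<sigma> i > i" "\<not> \<sigma> (Suc i) > Suc i"
      then have "i \<in> ?D \<longleftrightarrow> i \<in> ?E" unfolding D[OF i] E[OF i] by auto
      then show ?thesis using c by (simp add: e_def)
    qed
  qed
  have sum_restrict: "int (\<Sum>X) = (\<Sum>i\<in>?I. if i \<in> X then int i else 0)" if "X \<subseteq> ?I" for X
    using sum.inter_restrict[of ?I int X] unfolding Int_absorb1[OF that] by simp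
  have sub: "?D \<subseteq> ?I" "?E \<subseteq> ?I"
    using DES_subset[of "perm_word n \<sigma>"] DES_subset[of "bar_word n \<sigma>"] by (auto simp: perm_word_def)
  have "int (\<Sum>?D) - int (\<Sum>?E) = (\<Sum>i\<in>?I. int i * (e i - e (Suc i)))"
    unfolding sum_restrict[OF sub(1)] sum_restrict[OF sub(2)] sum_subtractf[symmetric]
    by (rule sum.cong[OF refl diff])
  also have "\<dots> = (\<Sum>i\<in>{1..n}. e i) - int n * e n" by (rule sum_mult_diff_Suc[OF True])
  also have "e n = 0" using range[of n] True by (simp add: e_def)
  also have "(\<Sum>i\<in>{1..n}. e i) = (\<Sum>i\<in>{1..n - 1}. e i)"
  proof -
    have "{1..n} = insert n {1..n - 1}" using True by auto
    then show ?thesis using True \<open>e n = 0\<close> by simp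
  qed
  also have "\<dots> = int (exc n \<sigma>)"
    proof -
    have "{1..n - 1} \<inter> {i. \<sigma> i > i} = {i \<in> {1..n - 1}. \<sigma> i > i}" by auto
    then show ?thesis unfolding e_def by (subst sum.If_cases) (simp_all add: exc_def)
  qed
  finally show ?thesis unfolding maj_def by linarith
qed

section \<open>Inversion over the subsets of a set of positions\<close>

lemma sum_subset_split:
  fixes h :: "'a \<Rightarrow> 'c::comm_monoid_add"
  assumes "finite Z" "finite S"
  shows "sum h {z \<in> Z. F z \<subseteq> S} =
    sum h {z \<in> Z. F z = S} + (\<Sum>S'\<in>Pow S - {S}. sum h {z \<in> Z. F z = S'})"
proof -
  have "sum h {z \<in> Z. F z \<subseteq> S} = (\<Sum>S'\<in>Pow S. sum h {z \<in> {z \<in> Z. F z \<subseteq> S}. F z = S'})"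
    by (rule sum.group[symmetric]) (use assms in auto)
  also have "\<dots> = (\<Sum>S'\<in>Pow S. sum h {z \<in> Z. F z = S'})"
    by (intro sum.cong arg_cong[where f = "sum h"]) auto
  also have "\<dots> = sum h {z \<in> Z. F z = S} + (\<Sum>S'\<in>Pow S - {S}. sum h {z \<in> Z. F z = S'})"
    by (rule sum.remove) (use assms in auto)
  finally show ?thesis .
qed

text \<open>Separating the term of \<open>S\<close> itself from the sum over all subsets leaves
  contributions of proper subsets, which agree by induction. So only conditions of the form
  \<open>DES w \<subseteq> S\<close> have to be treated afterwards.\<close>

lemma sum_by_subset_inversion:
  fixes f :: "'a \<Rightarrow> 'c::comm_ring_1" and g :: "'b \<Rightarrow> 'c"
  assumes "finite X" "finite Y" "finite S"
    and le: "\<And>S'. S' \<subseteq> S \<Longrightarrow> (\<Sum>x | x \<in> X \<and> D x \<subseteq> S'. f x) = (\<Sum>y | y \<in> Y \<and> E y \<subseteq> S'. g y)"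
  shows "(\<Sum>x | x \<in> X \<and> D x = S. f x) = (\<Sum>y | y \<in> Y \<and> E y = S. g y)"
  using assms(3) le
proof (induction S rule: finite_psubset_induct)
  case (psubset S)
  have "(\<Sum>x | x \<in> X \<and> D x \<subseteq> S. f x) =
      (\<Sum>x | x \<in> X \<and> D x = S. f x) + (\<Sum>S'\<in>Pow S - {S}. \<Sum>x | x \<in> X \<and> D x = S'. f x)"
    by (rule sum_subset_split) (use assms psubset.hyps in auto)
  moreover have "(\<Sum>y | y \<in> Y \<and> E y \<subseteq> S. g y) =
      (\<Sum>y | y \<in> Y \<and> E y = S. g y) + (\<Sum>S'\<in>Pow S - {S}. \<Sum>y | y \<in> Y \<and> E y = S'. g y)"
    by (rule sum_subset_split) (use assms psubset.hyps in auto)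
  moreover have "(\<Sum>S'\<in>Pow S - {S}. \<Sum>x | x \<in> X \<and> D x = S'. f x) =
      (\<Sum>S'\<in>Pow S - {S}. \<Sum>y | y \<in> Y \<and> E y = S'. g y)"
    by (rule sum.cong[OF refl], rule psubset.IH) (use psubset.prems in \<open>auto simp: psubset_eq\<close>)
  ultimately show ?case using psubset.prems[of S] by simp
qed

text \<open>Block sizes are listed from the last block to the first, so that \<open>k # c\<close> adds a block at
  the end, which gets the number \<open>length c\<close>.\<close>

fun bsorted :: "nat list \<Rightarrow> nat list \<Rightarrow> bool" where
  "bsorted [] w \<longleftrightarrow> w = []"
| "bsorted (k # c) w \<longleftrightarrow>
     length w = sum_list c + k \<and> bsorted c (take (sum_list c) w) \<and> sorted (drop (sum_list c) w)"

lemma bsorted_length: "bsorted c w \<Longrightarrow> length w = sum_list c"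
  by (cases c) auto

lemma sorted_iff_DES_empty: "sorted w \<longleftrightarrow> DES w = {}"
proof
  assume s: "sorted w"
  have "i \<notin> DES w" for i
  proof
    assume "i \<in> DES w"
    then have "i < length w" "w ! i < w ! (i - 1)" by (auto simp: DES_def)
    moreover have "w ! (i - 1) \<le> w ! i" using s \<open>i < length w\<close> by (intro sorted_nth_mono) auto
    ultimately show False by simp
  qed
  then show "DES w = {}" by blast
next
  assume D: "DES w = {}"
  have "w ! i \<le> w ! Suc i" if "Suc i < length w" for i
  proof -
    have "Suc i \<notin> DES w" using D by simp
    then show ?thesis using that by (auto simp: DES_def not_less)
  qed
  then show "sorted w" by (simp add: sorted_iff_nth_Suc)
qed

text \<open>In the application \<open>m\<close> is the largest element of \<open>S\<close>, or 0 if
  \<open>S\<close> is empty. A descent before \<open>m\<close> is one of the prefix, a descent after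
  \<open>m\<close> one of the suffix, and a descent at \<open>m\<close> itself is permitted because
  \<open>m\<close> then lies in \<open>S\<close>.\<close>

lemma DES_append_subset_iff:
  assumes "length w = m + k" "S \<subseteq> {1..m}" "m \<in> S \<or> m = 0"
  shows "DES w \<subseteq> S \<longleftrightarrow> DES (take m w) \<subseteq> S - {m} \<and> sorted (drop m w)"
proof -
  have 1: "DES (take m w) = DES w \<inter> {..<m}" using assms(1) by (auto simp: DES_def)
  have 2: "i \<in> DES (drop m w) \<longleftrightarrow> i \<ge> 1 \<and> m + i \<in> DES w" for i
    using assms(1) by (cases i) (auto simp: DES_def)
  have "DES (drop m w) = {} \<longleftrightarrow> (\<forall>i\<in>DES w. i \<le> m)"
  proof (intro iffI ballI)
    fix i assume e: "DES (drop m w) = {}" and i: "i \<in> DES w"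
    show "i \<le> m"
    proof (rule ccontr)
      assume "\<not> i \<le> m"
      then have "i - m \<in> DES (drop m w)" using 2[of "i - m"] i by auto
      then show False using e by simp
    qed
  next
    assume le: "\<forall>i\<in>DES w. i \<le> m"
    have "i \<notin> DES (drop m w)" for i
    proof
      assume "i \<in> DES (drop m w)"
      then have "i \<ge> 1" "m + i \<in> DES w" using 2 by auto
      then show False using le by force
    qed
    then show "DES (drop m w) = {}" by blast
  qed
  moreover have pos: "i > 0" if "i \<in> DES w" for i using that by (auto simp: DES_def)
  ultimately show ?thesis unfolding sorted_iff_DES_empty 1
  proof (intro iffI conjI subsetI ballI)
    fix i assume "DES w \<subseteq> S" "i \<in> DES w \<inter> {..<m}"
    then show "i \<in> S - {m}" by auto
  next
    assume "DES w \<subseteq> S" and e: "DES (drop m w) = {} \<longleftrightarrow> (\<forall>i\<in>DES w. i \<le> m)"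
    then have "\<forall>i\<in>DES w. i \<le> m" using assms(2) by (meson atLeastAtMost_iff subsetD)
    then show "DES (drop m w) = {}" using e by blast
  next
    fix i assume a: "DES w \<inter> {..<m} \<subseteq> S - {m} \<and> DES (drop m w) = {}" "i \<in> DES w"
      and e: "DES (drop m w) = {} \<longleftrightarrow> (\<forall>i\<in>DES w. i \<le> m)"
    then have "i \<le> m" "i > 0" using pos by auto
    show "i \<in> S"
    proof (cases "i = m")
      case True
      then show ?thesis using assms(3) \<open>i > 0\<close> by auto
    next
      case False
      then have "i \<in> DES w \<inter> {..<m}" using a(2) \<open>i \<le> m\<close> by simp
      then show ?thesis using a(1) by blast
    qed
  qed
qed

text \<open>The block sizes are the gaps between consecutive elements of \<open>S\<close> together
  with 0 and \<open>n\<close>. The induction splits off the last block.\<close>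

lemma ex_bsorted_iff_DES_subset:
  assumes "S \<subseteq> {1..<n}"
  shows "\<exists>c. sum_list c = n \<and> (\<forall>w. length w = n \<longrightarrow> (bsorted c w \<longleftrightarrow> DES w \<subseteq> S))"
  using assms
proof (induction n arbitrary: S rule: less_induct)
  case (less n)
  show ?case
  proof (cases "n = 0")
    case True
    have "bsorted [] w \<longleftrightarrow> DES w \<subseteq> S" if "length w = n" for w
      using that True by (simp add: DES_def)
    then show ?thesis using True by (intro exI[of _ "[]"]) simp
  next
    case False
    \<comment> \<open>The largest cut; 0, the beginning of the word, if \<open>S\<close> is
      empty.\<close>
    define m where "m = Max (insert 0 S)"
    have fin: "finite S" using less.prems finite_subset by blast
    have "m \<in> insert 0 S" unfolding m_def by (rule Max_in) (use fin in auto)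
    then have m: "m \<in> S \<or> m = 0" by blast
    have S: "S \<subseteq> {1..m}"
    proof
      fix i assume i: "i \<in> S"
      then have "i \<le> m" unfolding m_def using fin by (intro Max_ge) auto
      then show "i \<in> {1..m}" using i less.prems by auto
    qed
    have mn: "m < n" using m
    proof
      assume "m \<in> S"
      then show ?thesis using less.prems by (meson atLeastLessThan_iff subsetD)
    qed (use False in simp)
    have "S - {m} \<subseteq> {1..<m}"
    proof
      fix i assume "i \<in> S - {m}"
      then have "i \<in> {1..m}" "i \<noteq> m" using S by auto
      then show "i \<in> {1..<m}" by simp
    qed
    from less.IH[OF mn this] obtain c where c: "sum_list c = m"
      "\<And>w. length w = m \<Longrightarrow> bsorted c w \<longleftrightarrow> DES w \<subseteq> S - {m}" by blast
    have "bsorted ((n - m) # c) w \<longleftrightarrow> DES w \<subseteq> S" if w: "length w = n" for w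
    proof -
      have "bsorted c (take m w) \<longleftrightarrow> DES (take m w) \<subseteq> S - {m}" using c(2) w mn by simp
      then show ?thesis using DES_append_subset_iff[of w m "n - m" S] w S m mn by (simp add: c(1))
    qed
    then show ?thesis using c(1) mn by (intro exI[of _ "(n - m) # c"]) auto
  qed
qed

section \<open>Equidistribution of maj and inv on words of given content\<close>

text \<open>The q-Pochhammer symbol \<open>(q; q)_n\<close>. It serves in place of the q-factorial,
  from which it differs by the factor \<open>(1 - q)^n\<close>.\<close>

definition q_poch :: "'a::comm_ring_1 \<Rightarrow> nat \<Rightarrow> 'a" where
  "q_poch q n = (\<Prod>i=1..n. 1 - q ^ i)"

definition num_gt :: "nat \<Rightarrow> nat multiset \<Rightarrow> nat" where
  "num_gt x M = size (filter_mset (\<lambda>y. y > x) M)"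

lemma inv_num_snoc:
  fixes w :: "nat list"
  shows "inv_num (w @ [x]) = inv_num w + num_gt x (mset w)"
proof -
  let ?A = "{(i, j). 1 \<le> i \<and> i < j \<and> j \<le> length w \<and> w ! (i - 1) > w ! (j - 1)}"
  let ?B = "(\<lambda>i. (Suc i, Suc (length w))) ` {i. i < length w \<and> w ! i > x}"
  have split: "{(i, j). 1 \<le> i \<and> i < j \<and> j \<le> length (w @ [x]) \<and> (w @ [x]) ! (i - 1) > (w @ [x]) ! (j - 1)}
      = ?A \<union> ?B" (is "?L = _")
  proof (intro set_eqI iffI)
    fix p assume "p \<in> ?L"
    then obtain i j where p: "p = (i, j)" and ij: "1 \<le> i" "i < j" "j \<le> Suc (length w)"
      "(w @ [x]) ! (i - 1) > (w @ [x]) ! (j - 1)" by auto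
    show "p \<in> ?A \<union> ?B"
    proof (cases "j = Suc (length w)")
      case True
      then have "p = (Suc (i - 1), Suc (length w))" "i - 1 < length w" "w ! (i - 1) > x"
        using ij p by (auto simp: nth_append split: if_splits)
      then show ?thesis by blast
    next
      case False
      then have "i - 1 < length w" "j - 1 < length w" "j \<le> length w" using ij by auto
      then have "p \<in> ?A" using ij p by (simp add: nth_append)
      then show ?thesis by blast
    qed
  next
    fix p assume "p \<in> ?A \<union> ?B"
    then show "p \<in> ?L" by (auto simp: nth_append)
  qed
  have fA: "finite ?A" by (rule finite_subset[of _ "{..length w} \<times> {..length w}"]) auto
  have "card (?A \<union> ?B) = card ?A + card ?B"
    by (rule card_Un_disjoint) (use fA in auto)
  also have "card ?B = card {i. i < length w \<and> w ! i > x}"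
    by (rule card_image) (auto intro: inj_onI)
  also have "\<dots> = num_gt x (mset w)"
    unfolding num_gt_def mset_filter[symmetric] size_mset length_filter_conv_card ..
  finally show ?thesis unfolding inv_num_def split .
qed

lemma DES_snoc:
  "DES (w @ [x]) = DES w \<union> (if w \<noteq> [] \<and> last w > x then {length w} else {})"
proof -
  have "i \<in> DES (w @ [x]) \<longleftrightarrow> i \<in> DES w \<or> (i = length w \<and> w \<noteq> [] \<and> last w > x)" for i
  proof (cases i "length w" rule: linorder_cases)
    case less
    then have "i - 1 < length w" by simp
    then have "(w @ [x]) ! i = w ! i" "(w @ [x]) ! (i - 1) = w ! (i - 1)"
      using less by (simp_all add: nth_append)
    then show ?thesis using less unfolding DES_def by simp
  next
    case equal
    have "i \<ge> 1 \<longleftrightarrow> w \<noteq> []" using equal by (cases w) simp_all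
    moreover have "(w @ [x]) ! i = x" using equal by simp
    moreover have "(w @ [x]) ! (i - 1) = last w" if "w \<noteq> []"
      using equal that by (simp add: nth_append last_conv_nth)
    ultimately show ?thesis using equal unfolding DES_def by auto
  next
    case greater
    then show ?thesis unfolding DES_def by simp
  qed
  then show ?thesis by (intro set_eqI) simp
qed

lemma inv_num_Nil [simp]: "inv_num [] = 0"
  unfolding inv_num_def by (rule card_eq_0_iff[THEN iffD2]) auto

lemma maj_Nil [simp]: "maj [] = 0"
  by (simp add: maj_def DES_def)

lemma maj_snoc:
  "maj (w @ [x]) = maj w + (if w \<noteq> [] \<and> last w > x then length w else 0)"
proof -
  have "length w \<notin> DES w" by (auto simp: DES_def)
  then show ?thesis by (simp add: maj_def DES_snoc finite_DES)
qed

lemma sum_permutations_of_multiset_snoc: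
  assumes "M \<noteq> {#}"
  shows "(\<Sum>w\<in>permutations_of_multiset M. g w) =
    (\<Sum>x\<in>set_mset M. \<Sum>w\<in>permutations_of_multiset (M - {#x#}). g (w @ [x]))"
proof -
  have "permutations_of_multiset M =
      (\<Union>x\<in>set_mset M. (\<lambda>w. w @ [x]) ` permutations_of_multiset (M - {#x#}))" (is "?L = ?R")
  proof (intro set_eqI iffI)
    fix w assume "w \<in> ?L"
    then have M: "mset w = M" by (simp add: permutations_of_multiset_def)
    then have "w \<noteq> []" using assms by auto
    then have w: "w = butlast w @ [last w]" by simp
    have "mset w = add_mset (last w) (mset (butlast w))" by (subst w) simp
    then have "mset (butlast w) = M - {#last w#}" "last w \<in># M" using M by auto
    then show "w \<in> ?R" using w by (force simp: permutations_of_multiset_def)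
  next
    fix w assume "w \<in> ?R"
    then show "w \<in> ?L" by (auto simp: permutations_of_multiset_def)
  qed
  then have "sum g (permutations_of_multiset M) =
      sum g (\<Union>x\<in>set_mset M. (\<lambda>w. w @ [x]) ` permutations_of_multiset (M - {#x#}))" by simp
  also have "\<dots> = (\<Sum>x\<in>set_mset M. sum g ((\<lambda>w. w @ [x]) ` permutations_of_multiset (M - {#x#})))"
    by (rule sum.UNION_disjoint) auto
  also have "\<dots> = (\<Sum>x\<in>set_mset M. \<Sum>w\<in>permutations_of_multiset (M - {#x#}). g (w @ [x]))"
    by (simp add: sum.reindex inj_on_def)
  finally show ?thesis .
qed

lemma filter_mset_ge_0: "filter_mset ((\<le>) 0) M = M" for M :: "nat multiset"
  by (rule multiset_eqI) simp

text \<open>If \<open>G x\<close> denotes \<open>q\<close> to the number of elements of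
  \<open>M\<close> that are at least \<open>x\<close>, each summand is
  \<open>G (x + 1) - G x\<close>. Numbers outside \<open>M\<close> have multiplicity 0 and
  contribute nothing, so the sum may run over the whole interval and telescopes.\<close>

lemma sum_num_gt_telescope:
  fixes q :: "'a::comm_ring_1"
  assumes "m \<le> n"
  shows "(\<Sum>x\<in>{y \<in> set_mset M. m \<le> y \<and> y < n}. q ^ num_gt x M * (1 - q ^ count M x)) =
    q ^ size (filter_mset (\<lambda>y. n \<le> y) M) - q ^ size (filter_mset (\<lambda>y. m \<le> y) M)"
proof -
  let ?g = "\<lambda>x. q ^ size (filter_mset (\<lambda>y. x \<le> y) M)"
  have step: "q ^ num_gt x M * (1 - q ^ count M x) = ?g (Suc x) - ?g x" for x
  proof -
    have "filter_mset (\<lambda>y. x \<le> y) M = filter_mset (\<lambda>y. x < y) M + filter_mset (\<lambda>y. y = x) M"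
      by (rule multiset_eqI) auto
    then have "size (filter_mset (\<lambda>y. x \<le> y) M) = num_gt x M + count M x"
      by (simp add: num_gt_def count_conv_size_mset eq_commute)
    moreover have "filter_mset (\<lambda>y. Suc x \<le> y) M = filter_mset (\<lambda>y. x < y) M"
      by (rule filter_mset_cong) auto
    ultimately show ?thesis by (simp add: num_gt_def algebra_simps power_add)
  qed
  have "(\<Sum>x\<in>{y \<in> set_mset M. m \<le> y \<and> y < n}. q ^ num_gt x M * (1 - q ^ count M x)) =
      (\<Sum>x\<in>{m..<n}. q ^ num_gt x M * (1 - q ^ count M x))"
    by (rule sum.mono_neutral_left) (auto, rule ccontr, simp add: not_in_iff)
  also have "\<dots> = (\<Sum>x=m..<n. ?g (Suc x) - ?g x)" by (simp only: step)
  also have "\<dots> = ?g n - ?g m" by (rule sum_Suc_diff'[OF assms])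
  finally show ?thesis .
qed

definition inv_gf :: "'a::comm_ring_1 \<Rightarrow> nat multiset \<Rightarrow> 'a" where
  "inv_gf q M = (\<Sum>w\<in>permutations_of_multiset M. q ^ inv_num w)"

lemma inv_gf_rec:
  assumes "M \<noteq> {#}"
  shows "inv_gf q M = (\<Sum>x\<in>set_mset M. q ^ num_gt x M * inv_gf q (M - {#x#}))"
proof -
  have "inv_gf q M = (\<Sum>x\<in>set_mset M. \<Sum>w\<in>permutations_of_multiset (M - {#x#}). q ^ inv_num (w @ [x]))"
    unfolding inv_gf_def by (rule sum_permutations_of_multiset_snoc[OF assms])
  also have "\<dots> = (\<Sum>x\<in>set_mset M. q ^ num_gt x M * inv_gf q (M - {#x#}))"
  proof (rule sum.cong[OF refl])
    fix x assume x: "x \<in># M"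
    have "num_gt x (M - {#x#}) = num_gt x M" by (simp add: num_gt_def)
    then show "(\<Sum>w\<in>permutations_of_multiset (M - {#x#}). q ^ inv_num (w @ [x])) =
        q ^ num_gt x M * inv_gf q (M - {#x#})"
      unfolding inv_gf_def sum_distrib_left
      by (intro sum.cong refl) (auto simp: inv_num_snoc power_add permutations_of_multiset_def mult.commute)
  qed
  finally show ?thesis .
qed

definition q_fact_mset :: "'a::comm_ring_1 \<Rightarrow> nat multiset \<Rightarrow> 'a" where
  "q_fact_mset q M = (\<Prod>x\<in>set_mset M. q_poch q (count M x))"

lemma q_fact_mset_remove:
  assumes "x \<in># M"
  shows "q_fact_mset q M = q_fact_mset q (M - {#x#}) * (1 - q ^ count M x)"
proof -
  obtain n where n: "count M x = Suc n" using assms by (metis count_greater_zero_iff gr0_implies_Suc)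
  have "q_fact_mset q (M - {#x#}) = (\<Prod>y\<in>set_mset M. q_poch q (count (M - {#x#}) y))"
    unfolding q_fact_mset_def
    by (rule prod.mono_neutral_left) (auto simp: not_in_iff q_poch_def dest: in_diffD)
  also have "\<dots> = q_poch q n * (\<Prod>y\<in>set_mset M - {x}. q_poch q (count M y))"
    using assms n by (subst prod.remove[of _ x]) auto
  finally show ?thesis
    using assms n unfolding q_fact_mset_def
    by (subst prod.remove[of _ x]) (auto simp: q_poch_def algebra_simps)
qed

text \<open>MacMahon's formula: \<open>inv_gf q M\<close> is the q-multinomial coefficient, here
  written without division. Removing the last letter \<open>x\<close> leaves, by induction, the
  common factor \<open>q_poch q n\<close>, and the remaining sum over \<open>x\<close> telescopes to
  \<open>1 - q ^ size M\<close>.\<close>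

lemma q_fact_mset_inv_gf:
  "q_fact_mset q M * inv_gf q M = q_poch q (size M)"
proof (induction "size M" arbitrary: M)
  case 0
  then have "M = {#}" by simp
  then show ?case by (simp add: q_fact_mset_def inv_gf_def q_poch_def)
next
  case (Suc n)
  then have M: "M \<noteq> {#}" by auto
  define B where "B = Suc (Max (set_mset M))"
  have B: "x < B" if "x \<in># M" for x using that by (auto simp: B_def less_Suc_eq_le)
  have "q_fact_mset q M * inv_gf q M =
      (\<Sum>x\<in>set_mset M. q_fact_mset q M * (q ^ num_gt x M * inv_gf q (M - {#x#})))"
    by (subst inv_gf_rec[OF M]) (simp add: sum_distrib_left)
  also have "\<dots> = (\<Sum>x\<in>set_mset M. q_poch q n * (q ^ num_gt x M * (1 - q ^ count M x)))"
  proof (rule sum.cong[OF refl])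
    fix x assume x: "x \<in># M"
    then have s: "size (M - {#x#}) = n" using Suc.hyps(2) by (simp add: size_Diff_singleton)
    have "q_fact_mset q M * (q ^ num_gt x M * inv_gf q (M - {#x#})) =
      (q_fact_mset q (M - {#x#}) * inv_gf q (M - {#x#})) * (q ^ num_gt x M * (1 - q ^ count M x))"
      by (simp add: q_fact_mset_remove[OF x] algebra_simps)
    then show "q_fact_mset q M * (q ^ num_gt x M * inv_gf q (M - {#x#})) =
      q_poch q n * (q ^ num_gt x M * (1 - q ^ count M x))"
      using Suc.hyps(1)[of "M - {#x#}"] s by simp
  qed
  also have "\<dots> = q_poch q n * (\<Sum>x\<in>{y \<in> set_mset M. 0 \<le> y \<and> y < B}. q ^ num_gt x M * (1 - q ^ count M x))"
    using B by (auto simp: sum_distrib_left intro!: sum.cong)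
  also have "\<dots> = q_poch q n * (1 - q ^ size M)"
  proof -
    have fB: "filter_mset (\<lambda>y. B \<le> y) M = {#}" using B by (auto simp: filter_mset_eq_conv not_le)
    show ?thesis by (subst sum_num_gt_telescope) (simp_all add: filter_mset_ge_0 fB)
  qed
  also have "\<dots> = q_poch q (size M)" using Suc.hyps(2)[symmetric] by (simp add: q_poch_def)
  finally show ?case .
qed

text \<open>The ratio of two neighbouring q-multinomial coefficients. Since no positive power of
  \<open>q\<close> is 1, \<open>q_fact_mset\<close> is nonzero and can be cancelled.\<close>

lemma inv_gf_remove:
  fixes q :: "'a::idom"
  assumes "x \<in># M" and q: "\<And>i. i > 0 \<Longrightarrow> q ^ i \<noteq> 1"
  shows "(1 - q ^ size M) * inv_gf q (M - {#x#}) = (1 - q ^ count M x) * inv_gf q M"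
proof -
  define M' where "M' = M - {#x#}"
  have s: "size M = Suc (size M')" using assms(1) by (simp add: M'_def size_Suc_Diff1)
  have "q_fact_mset q M' \<noteq> 0"
    using q by (auto simp: q_fact_mset_def q_poch_def)
  moreover have "q_fact_mset q M' * ((1 - q ^ size M) * inv_gf q M') =
      q_fact_mset q M' * ((1 - q ^ count M x) * inv_gf q M)"
  proof -
    have "q_fact_mset q M' * ((1 - q ^ size M) * inv_gf q M') = q_poch q (size M') * (1 - q ^ size M)"
      by (simp flip: q_fact_mset_inv_gf)
    also have "\<dots> = q_poch q (size M)" by (simp add: s q_poch_def)
    also have "\<dots> = q_fact_mset q M * inv_gf q M" by (simp add: q_fact_mset_inv_gf)
    also have "\<dots> = q_fact_mset q M' * ((1 - q ^ count M x) * inv_gf q M)"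
      by (simp add: q_fact_mset_remove[OF assms(1)] M'_def)
    finally show ?thesis .
  qed
  ultimately show ?thesis unfolding M'_def by simp
qed

text \<open>For the induction the last letter is kept fixed: \<open>maj\<close> is distributed like
  \<open>inv_num\<close> even among the words of given content that end in \<open>x\<close>. The
  letter \<open>y\<close> before \<open>x\<close> decides whether \<open>size M\<close> is a
  descent. After multiplication by \<open>1 - q ^ size M\<close>, \<open>inv_gf_remove\<close>
  applies for each \<open>y\<close>, and the sum over \<open>y\<close> telescopes separately for
  \<open>y \<le> x\<close> and \<open>y > x\<close>.\<close>

lemma sum_maj_snoc:
  fixes q :: "'a::idom"
  assumes q: "\<And>i. i > 0 \<Longrightarrow> q ^ i \<noteq> 1"
  shows "(\<Sum>w\<in>permutations_of_multiset M. q ^ maj (w @ [x])) = q ^ num_gt x M * inv_gf q M"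
proof (induction "size M" arbitrary: M x)
  case 0
  then have "M = {#}" by simp
  then show ?case using maj_snoc[of "[]" x] by (simp add: num_gt_def inv_gf_def)
next
  case (Suc n)
  let ?J = "\<lambda>M x. \<Sum>w\<in>permutations_of_multiset M. q ^ maj (w @ [x])"
  let ?n = "size M"
  have M: "M \<noteq> {#}" using Suc.hyps(2) by auto
  \<comment> \<open>A bound above \<open>x\<close> and all letters of \<open>M\<close>, so that the
    second telescoping sum runs from \<open>Suc x\<close> to a point with no letters beyond
    it.\<close>
  define B where "B = Suc (x + Max (set_mset M))"
  have B: "y < B" if "y \<in># M" for y
    using Max_ge[OF finite_set_mset that] by (simp add: B_def)
  have fB: "filter_mset (\<lambda>y. B \<le> y) M = {#}" using B by (auto simp: filter_mset_eq_conv not_le)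
  have "?J M x = (\<Sum>y\<in>set_mset M. (if y > x then q ^ ?n else 1) * ?J (M - {#y#}) y)"
  proof (subst sum_permutations_of_multiset_snoc[OF M], rule sum.cong[OF refl])
    fix y assume y: "y \<in># M"
    then have s: "?n = Suc (size (M - {#y#}))" by (simp add: size_Suc_Diff1)
    show "(\<Sum>w\<in>permutations_of_multiset (M - {#y#}). q ^ maj ((w @ [y]) @ [x])) =
        (if y > x then q ^ ?n else 1) * ?J (M - {#y#}) y"
      unfolding sum_distrib_left
    proof (rule sum.cong[OF refl])
      fix w assume "w \<in> permutations_of_multiset (M - {#y#})"
      then have "length w = size (M - {#y#})"
        by (metis permutations_of_multisetD size_mset)
      then have "maj ((w @ [y]) @ [x]) = maj (w @ [y]) + (if y > x then ?n else 0)"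
        using s by (subst maj_snoc) auto
      then show "q ^ maj ((w @ [y]) @ [x]) = (if y > x then q ^ ?n else 1) * q ^ maj (w @ [y])"
        by (simp add: power_add mult.commute)
    qed
  qed
  also have "\<dots> = (\<Sum>y\<in>set_mset M. (if y > x then q ^ ?n else 1) * (q ^ num_gt y M * inv_gf q (M - {#y#})))"
  proof (rule sum.cong[OF refl])
    fix y assume y: "y \<in># M"
    have "n = size (M - {#y#})" using Suc.hyps(2) y by (simp add: size_Diff_singleton)
    moreover have "num_gt y (M - {#y#}) = num_gt y M" by (simp add: num_gt_def)
    ultimately show "(if y > x then q ^ ?n else 1) * ?J (M - {#y#}) y =
        (if y > x then q ^ ?n else 1) * (q ^ num_gt y M * inv_gf q (M - {#y#}))"
      using Suc.hyps(1)[of "M - {#y#}" y] by simp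
  qed
  finally have "(1 - q ^ ?n) * ?J M x =
      (\<Sum>y\<in>set_mset M. (if y > x then q ^ ?n else 1) * q ^ num_gt y M * ((1 - q ^ ?n) * inv_gf q (M - {#y#})))"
    by (simp add: sum_distrib_left algebra_simps)
  also have "\<dots> = (\<Sum>y\<in>set_mset M.
      (if y > x then q ^ ?n else 1) * (q ^ num_gt y M * (1 - q ^ count M y))) * inv_gf q M"
    unfolding sum_distrib_right
    by (rule sum.cong[OF refl]) (simp only: inv_gf_remove[OF _ q] mult.assoc)
  also have "(\<Sum>y\<in>set_mset M. (if y > x then q ^ ?n else 1) * (q ^ num_gt y M * (1 - q ^ count M y))) =
      (\<Sum>y\<in>{y \<in> set_mset M. 0 \<le> y \<and> y < Suc x}. q ^ num_gt y M * (1 - q ^ count M y)) +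
      q ^ ?n * (\<Sum>y\<in>{y \<in> set_mset M. Suc x \<le> y \<and> y < B}. q ^ num_gt y M * (1 - q ^ count M y))"
  proof -
    let ?h = "\<lambda>y. (if y > x then q ^ ?n else 1) * (q ^ num_gt y M * (1 - q ^ count M y))"
    let ?A = "{y \<in> set_mset M. 0 \<le> y \<and> y < Suc x}" and ?B = "{y \<in> set_mset M. Suc x \<le> y \<and> y < B}"
    have "sum ?h (set_mset M) = sum ?h (?A \<union> ?B)" by (rule sum.cong) (use B in auto)
    also have "\<dots> = sum ?h ?A + sum ?h ?B" by (rule sum.union_disjoint) auto
    also have "sum ?h ?A = (\<Sum>y\<in>?A. q ^ num_gt y M * (1 - q ^ count M y))"
      by (rule sum.cong) auto
    also have "sum ?h ?B = q ^ ?n * (\<Sum>y\<in>?B. q ^ num_gt y M * (1 - q ^ count M y))"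
      unfolding sum_distrib_left by (rule sum.cong) auto
    finally show ?thesis .
  qed
  also have "\<dots> = (1 - q ^ ?n) * q ^ num_gt x M"
  proof -
    have "num_gt x M = size (filter_mset (\<lambda>y. Suc x \<le> y) M)"
      unfolding num_gt_def by (rule arg_cong[where f = size], rule filter_mset_cong) auto
    moreover have "Suc x \<le> B" by (simp add: B_def)
    ultimately show ?thesis
      by (subst (1 2) sum_num_gt_telescope) (auto simp: fB filter_mset_ge_0 algebra_simps)
  qed
  finally have "(1 - q ^ ?n) * ?J M x = (1 - q ^ ?n) * (q ^ num_gt x M * inv_gf q M)"
    by (simp add: algebra_simps)
  moreover have "1 - q ^ ?n \<noteq> 0" using q[of ?n] Suc.hyps(2) by auto
  ultimately show ?case by simp
qed

theorem maj_inv_equidistributed: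
  fixes q :: "'a::idom" and M :: "nat multiset"
  assumes q: "\<And>i. i > 0 \<Longrightarrow> q ^ i \<noteq> 1"
  shows "(\<Sum>w\<in>permutations_of_multiset M. q ^ maj w) = (\<Sum>w\<in>permutations_of_multiset M. q ^ inv_num w)"
proof (cases "M = {#}")
  case True
  then show ?thesis by simp
next
  case False
  have "(\<Sum>w\<in>permutations_of_multiset M. q ^ maj w) =
      (\<Sum>x\<in>set_mset M. q ^ num_gt x (M - {#x#}) * inv_gf q (M - {#x#}))"
    by (subst sum_permutations_of_multiset_snoc[OF False]) (simp only: sum_maj_snoc[OF q])
  also have "\<dots> = inv_gf q M"
    by (simp add: inv_gf_rec[OF False] num_gt_def)
  finally show ?thesis by (simp add: inv_gf_def)
qed

section \<open>Weighted sums over words of given content\<close>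

definition words_on :: "nat set \<Rightarrow> nat \<Rightarrow> (nat \<Rightarrow> nat) \<Rightarrow> (nat \<Rightarrow> nat) set" where
  "words_on X N c = {v \<in> X \<rightarrow>\<^sub>E {..<N}. \<forall>a<N. card {j \<in> X. v j = a} = c a}"

definition word_sum :: "nat set \<Rightarrow> nat \<Rightarrow> (nat \<Rightarrow> nat \<Rightarrow> 'a::comm_ring_1) \<Rightarrow> (nat \<Rightarrow> nat) \<Rightarrow> 'a" where
  "word_sum X N w c = (\<Sum>v\<in>words_on X N c. \<Prod>j\<in>X. w j (v j))"

lemma finite_words_on: "finite X \<Longrightarrow> finite (words_on X N c)"
  unfolding words_on_def by (rule finite_subset[of _ "X \<rightarrow>\<^sub>E {..<N}"]) (auto intro: finite_PiE)

lemma words_on_less: "v \<in> words_on X N c \<Longrightarrow> j \<in> X \<Longrightarrow> v j < N"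
  unfolding words_on_def by (auto simp: PiE_def Pi_def)

lemma word_sum_cong:
  assumes "\<And>j a. j \<in> X \<Longrightarrow> a < N \<Longrightarrow> w j a = w' j a" "\<And>a. a < N \<Longrightarrow> c a = c' a"
  shows "word_sum X N w c = word_sum X N w' c'"
proof -
  have "words_on X N c = words_on X N c'" unfolding words_on_def using assms(2) by simp
  then show ?thesis unfolding word_sum_def
    by (intro sum.cong prod.cong) (auto intro!: assms(1) dest: words_on_less)
qed

lemma word_sum_reindex:
  assumes h: "bij_betw h X X'"
  shows "word_sum X' N w c = word_sum X N (\<lambda>j. w (h j)) c"
  unfolding word_sum_def
proof (rule sum.reindex_bij_witness[where i = "\<lambda>v. restrict (\<lambda>x. v (inv_into X h x)) X'"
      and j = "\<lambda>v. restrict (\<lambda>x. v (h x)) X"])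
  have hX: "h x \<in> X'" if "x \<in> X" for x using h that by (auto simp: bij_betw_def)
  have iX: "inv_into X h x \<in> X" if "x \<in> X'" for x using h that by (metis bij_betw_def inv_into_into)
  have hi: "h (inv_into X h x) = x" if "x \<in> X'" for x using h that by (rule bij_betw_inv_into_right)
  have ih: "inv_into X h (h x) = x" if "x \<in> X" for x using h that by (rule bij_betw_inv_into_left)
  {
    fix v assume v: "v \<in> words_on X' N c"
    then have vx: "v \<in> extensional X'" by (auto simp: words_on_def PiE_def)
    show "restrict (\<lambda>x. restrict (\<lambda>x. v (h x)) X (inv_into X h x)) X' = v"
      by (rule ext) (use vx iX hi in \<open>auto simp: extensional_def restrict_def\<close>)
    show "restrict (\<lambda>x. v (h x)) X \<in> words_on X N c"
    proof -
      have "card {j \<in> X. v (h j) = a} = card {j \<in> X'. v j = a}" for a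
        by (rule bij_betw_same_card[of h])
          (use h in \<open>auto simp: bij_betw_def inj_on_def\<close>)
      moreover have "{j \<in> X. restrict (\<lambda>x. v (h x)) X j = a} = {j \<in> X. v (h j) = a}" for a by auto
      ultimately show ?thesis using v hX by (auto simp: words_on_def PiE_def Pi_def)
    qed
    show "(\<Prod>j\<in>X. w (h j) (restrict (\<lambda>x. v (h x)) X j)) = (\<Prod>j\<in>X'. w j (v j))"
      using prod.reindex_bij_betw[OF h, of "\<lambda>j. w j (v j)"] by simp
  }
  fix v assume v: "v \<in> words_on X N c"
  then have vx: "v \<in> extensional X" by (auto simp: words_on_def PiE_def)
  show "restrict (\<lambda>x. restrict (\<lambda>x. v (inv_into X h x)) X' (h x)) X = v"
    by (rule ext) (use vx hX ih in \<open>auto simp: extensional_def restrict_def\<close>)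
  show "restrict (\<lambda>x. v (inv_into X h x)) X' \<in> words_on X' N c"
  proof -
    have "bij_betw (inv_into X h) X' X" using h by (rule bij_betw_inv_into)
    then have "card {j \<in> X'. v (inv_into X h j) = a} = card {j \<in> X. v j = a}" for a
      by (intro bij_betw_same_card[of "inv_into X h"]) (auto simp: bij_betw_def inj_on_def)
    moreover have "{j \<in> X'. restrict (\<lambda>x. v (inv_into X h x)) X' j = a} =
      {j \<in> X'. v (inv_into X h j) = a}" for a by auto
    ultimately show ?thesis using v iX by (auto simp: words_on_def PiE_def Pi_def)
  qed
qed

text \<open>In the expansion \<open>T\<close> is the set of the positions that contribute
  \<open>u\<close>. Such a position keeps the weight 1 for every letter, because its letter still
  counts towards the content.\<close>

lemma word_sum_add_const:
  assumes "finite X"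
  shows "word_sum X N (\<lambda>j a. w j a + u) c =
    (\<Sum>T\<in>Pow X. u ^ card T * word_sum X N (\<lambda>j a. if j \<in> T then 1 else w j a) c)"
proof -
  have "(\<Prod>j\<in>X. w j (v j) + u) = (\<Sum>T\<in>Pow X. u ^ card T * (\<Prod>j\<in>X. if j \<in> T then 1 else w j (v j)))" for v
  proof -
    have "(\<Prod>j\<in>X. w j (v j) + u) = (\<Prod>j\<in>X. u + w j (v j))" by (simp add: add.commute)
    also have "\<dots> = (\<Sum>T\<in>Pow X. (\<Prod>j\<in>T. u) * (\<Prod>j\<in>X - T. w j (v j)))"
      by (rule prod_add[OF assms])
    also have "\<dots> = (\<Sum>T\<in>Pow X. u ^ card T * (\<Prod>j\<in>X. if j \<in> T then 1 else w j (v j)))"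
    proof (rule sum.cong[OF refl])
      fix T assume "T \<in> Pow X"
      have "(\<Prod>j\<in>X. if j \<in> T then 1 else w j (v j)) = (\<Prod>j\<in>X - T. w j (v j))"
        by (rule prod.mono_neutral_cong_right) (use assms in auto)
      then show "(\<Prod>j\<in>T. u) * (\<Prod>j\<in>X - T. w j (v j)) =
          u ^ card T * (\<Prod>j\<in>X. if j \<in> T then 1 else w j (v j))" by simp
    qed
    finally show ?thesis .
  qed
  then show ?thesis
    unfolding word_sum_def sum_distrib_left by (simp add: sum.swap[of _ "Pow X"])
qed

text \<open>Applied below to \<open>fps_const\<close>, to \<open>fps_eval u\<close> and to
  evaluation at 0.\<close>

lemma word_sum_hom:
  fixes h :: "'a::comm_ring_1 \<Rightarrow> 'b::comm_ring_1"
  assumes "h 0 = 0" "h 1 = 1" "\<And>x y. h (x + y) = h x + h y" "\<And>x y. h (x * y) = h x * h y"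
  shows "h (word_sum X N w c) = word_sum X N (\<lambda>j a. h (w j a)) c"
proof -
  have s: "h (sum f A) = sum (\<lambda>x. h (f x)) A" for f :: "(nat \<Rightarrow> nat) \<Rightarrow> 'a" and A
    by (induction A rule: infinite_finite_induct) (simp_all add: assms)
  have p: "h (prod f A) = prod (\<lambda>x. h (f x)) A" for f :: "nat \<Rightarrow> 'a" and A
    by (induction A rule: infinite_finite_induct) (simp_all add: assms)
  show ?thesis by (simp add: word_sum_def s p)
qed

lemma word_sum_const_on:
  assumes "finite X" "T \<subseteq> X"
  shows "word_sum X N (\<lambda>j a. if j \<in> T then p else w j a) c =
    p ^ card T * word_sum X N (\<lambda>j a. if j \<in> T then 1 else w j a) c"
proof -
  have "(\<Prod>j\<in>X. if j \<in> T then p else w j (v j)) =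
      p ^ card T * (\<Prod>j\<in>X. if j \<in> T then 1 else w j (v j))" for v
  proof -
    have "(\<Prod>j\<in>X. if j \<in> T then p else w j (v j)) =
        (\<Prod>j\<in>X. (if j \<in> T then p else 1) * (if j \<in> T then 1 else w j (v j)))"
      by (rule prod.cong) auto
    moreover have "X \<inter> T = T" using assms(2) by blast
    ultimately show ?thesis using assms(1) by (simp add: prod.distrib prod.If_cases)
  qed
  then show ?thesis unfolding word_sum_def by (simp add: sum_distrib_left)
qed

lemma word_sum_Suc:
  assumes "finite X"
  shows "word_sum X (Suc N) w c =
    (\<Sum>S | S \<subseteq> X \<and> card S = c N. (\<Prod>j\<in>S. w j N) * word_sum (X - S) N w c)"
proof -
  let ?F = "\<lambda>v. \<Prod>j\<in>X. w j (v j)"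
  let ?S = "{S. S \<subseteq> X \<and> card S = c N}"
  have "word_sum X (Suc N) w c = (\<Sum>S\<in>?S. \<Sum>v | v \<in> words_on X (Suc N) c \<and> {j \<in> X. v j = N} = S. ?F v)"
    unfolding word_sum_def
    by (rule sum.group[symmetric])
      (use assms finite_words_on in \<open>auto simp: words_on_def\<close>)
  also have "\<dots> = (\<Sum>S\<in>?S. (\<Prod>j\<in>S. w j N) * word_sum (X - S) N w c)"
  proof (rule sum.cong[OF refl])
    fix S assume "S \<in> ?S"
    then have S: "S \<subseteq> X" "card S = c N" by auto
    have "(\<Sum>v | v \<in> words_on X (Suc N) c \<and> {j \<in> X. v j = N} = S. ?F v) =
        (\<Sum>v\<in>words_on (X - S) N c. (\<Prod>j\<in>S. w j N) * (\<Prod>j\<in>X - S. w j (v j)))"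
    proof (rule sum.reindex_bij_witness[where j = "\<lambda>v. restrict v (X - S)"
          and i = "\<lambda>v j. if j \<in> S then N else v j"])
      fix v assume "v \<in> {v. v \<in> words_on X (Suc N) c \<and> {j \<in> X. v j = N} = S}"
      then have v: "v \<in> words_on X (Suc N) c" and vS: "{j \<in> X. v j = N} = S" by auto
      have vx: "v j = undefined" if "j \<notin> X" for j
        using v that by (auto simp: words_on_def PiE_def extensional_def)
      show "(\<lambda>j. if j \<in> S then N else restrict v (X - S) j) = v"
        by (rule ext) (use vS vx in auto)
      have "{j \<in> X - S. restrict v (X - S) j = a} = {j \<in> X. v j = a}" if "a < N" for a
        using vS that by auto
      moreover have "v j < N" if "j \<in> X - S" for j
        using words_on_less[OF v, of j] vS that by (auto simp: less_Suc_eq)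
      ultimately show "restrict v (X - S) \<in> words_on (X - S) N c"
        using v by (auto simp: words_on_def)
      have "?F v = (\<Prod>j\<in>S. w j (v j)) * (\<Prod>j\<in>X - S. w j (v j))"
        using prod.subset_diff[OF S(1) assms, of "\<lambda>j. w j (v j)"] by (simp add: mult.commute)
      also have "(\<Prod>j\<in>S. w j (v j)) = (\<Prod>j\<in>S. w j N)"
        by (rule prod.cong) (use vS in auto)
      finally show "(\<Prod>j\<in>S. w j N) * (\<Prod>j\<in>X - S. w j (restrict v (X - S) j)) = ?F v" by simp
    next
      fix v assume v: "v \<in> words_on (X - S) N c"
      have vx: "v j = undefined" if "j \<notin> X - S" for j
        using v that by (auto simp: words_on_def PiE_def extensional_def)
      have less: "v j < N" if "j \<in> X - S" for j
        using words_on_less[OF v that] .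
      let ?v = "\<lambda>j. if j \<in> S then N else v j"
      show "restrict ?v (X - S) = v" by (rule ext) (use vx in \<open>auto simp: restrict_def\<close>)
      have N: "{j \<in> X. ?v j = N} = S" using S(1) less by force
      have "{j \<in> X. ?v j = a} = {j \<in> X - S. v j = a}" if "a < N" for a
        using that S(1) by auto
      then have "card {j \<in> X. ?v j = a} = c a" if "a < Suc N" for a
        using that v N S(2) by (cases "a = N") (auto simp: words_on_def)
      moreover have "?v \<in> X \<rightarrow>\<^sub>E {..<Suc N}"
        using less vx S(1) by (auto simp: PiE_def Pi_def extensional_def less_Suc_eq)
      ultimately show "?v \<in> {v. v \<in> words_on X (Suc N) c \<and> {j \<in> X. v j = N} = S}"
        using N by (simp add: words_on_def)
    qed
    then show "(\<Sum>v | v \<in> words_on X (Suc N) c \<and> {j \<in> X. v j = N} = S. ?F v) =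
        (\<Prod>j\<in>S. w j N) * word_sum (X - S) N w c"
      by (simp add: word_sum_def sum_distrib_left)
  qed
  finally show ?thesis .
qed

text \<open>The positions \<open>T\<close> outside \<open>B\<close> carrying \<open>N\<close> are as many as the positions \<open>I\<close> in \<open>B\<close>
  not carrying \<open>N\<close>, so the word on the remaining positions can be transported to \<open>A\<close>.\<close>

lemma word_sum_eliminate:
  assumes fin: "finite A" "finite B" and disj: "A \<inter> B = {}" and cN: "c N = card B"
    and wA: "\<And>j. j \<in> A \<Longrightarrow> w j N = q"
    and wB: "\<And>j a. j \<in> B \<Longrightarrow> a < N \<Longrightarrow> w j a = p"
  shows "word_sum (A \<union> B) (Suc N) w c =
    (\<Sum>T\<in>Pow A. (p * q) ^ card T * word_sum A N (\<lambda>j a. if j \<in> T then 1 else w j a) c *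
       (\<Sum>I | I \<subseteq> B \<and> card I = card T. \<Prod>j\<in>B - I. w j N))"
proof -
  let ?G = "\<lambda>T. word_sum A N (\<lambda>j a. if j \<in> T then 1 else w j a) c"
  have main: "(\<Prod>j\<in>T \<union> (B - I). w j N) * word_sum ((A \<union> B) - (T \<union> (B - I))) N w c =
      (p * q) ^ card T * ?G T * (\<Prod>j\<in>B - I. w j N)"
    if TI: "T \<subseteq> A" "I \<subseteq> B" "card I = card T" for T I
  proof -
    have finTI: "finite T" "finite I" using TI fin finite_subset by auto
    then obtain g where g: "bij_betw g T I" using TI(3) by (metis finite_same_card_bij)
    \<comment> \<open>The positions of \<open>T\<close> are exchanged for those of \<open>I\<close>.
      Any bijection will do, as all positions in \<open>B\<close> give the same weight
      \<open>p\<close> to every letter below \<open>N\<close>.\<close>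
    let ?h = "\<lambda>j. if j \<in> T then g j else j"
    have eq: "(A \<union> B) - (T \<union> (B - I)) = (A - T) \<union> I" using TI disj by blast
    have "bij_betw ?h (A - T \<union> T) ((A - T) \<union> I)"
    proof (rule bij_betw_combine)
      show "bij_betw ?h (A - T) (A - T)" by (rule bij_betw_cong[THEN iffD1, OF _ bij_betw_id]) auto
      show "bij_betw ?h T I" by (rule bij_betw_cong[THEN iffD1, OF _ g]) auto
      show "(A - T) \<inter> I = {}" using TI disj by blast
    qed
    then have h: "bij_betw ?h A ((A - T) \<union> I)" using TI(1) by (simp add: Un_absorb2)
    have "word_sum ((A - T) \<union> I) N w c = word_sum A N (\<lambda>j. w (?h j)) c"
      by (rule word_sum_reindex[OF h])
    also have "\<dots> = word_sum A N (\<lambda>j a. if j \<in> T then p else w j a) c"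
    proof (rule word_sum_cong)
      fix j a assume "j \<in> A" "a < N"
      then show "w (?h j) a = (if j \<in> T then p else w j a)"
        using wB[of "g j" a] g TI(2) by (auto simp: bij_betw_def)
    qed simp
    also have "\<dots> = p ^ card T * ?G T" by (rule word_sum_const_on[OF fin(1) TI(1)])
    finally have 1: "word_sum ((A - T) \<union> I) N w c = p ^ card T * ?G T" .
    have "(\<Prod>j\<in>T \<union> (B - I). w j N) = (\<Prod>j\<in>T. w j N) * (\<Prod>j\<in>B - I. w j N)"
      by (rule prod.union_disjoint) (use finTI fin TI disj in auto)
    also have "(\<Prod>j\<in>T. w j N) = (\<Prod>j\<in>T. q)" by (rule prod.cong) (use TI wA in auto)
    finally show ?thesis unfolding eq 1 by (simp add: power_mult_distrib algebra_simps)
  qed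
  have "word_sum (A \<union> B) (Suc N) w c =
      (\<Sum>S | S \<subseteq> A \<union> B \<and> card S = c N. (\<Prod>j\<in>S. w j N) * word_sum (A \<union> B - S) N w c)"
    by (rule word_sum_Suc) (use fin in simp)
  also have "\<dots> = (\<Sum>(T, I)\<in>(SIGMA T:Pow A. {I. I \<subseteq> B \<and> card I = card T}).
      (p * q) ^ card T * ?G T * (\<Prod>j\<in>B - I. w j N))"
  \<comment> \<open>\<open>S\<close> is the set of positions that carry \<open>N\<close>. Having as
    many elements as \<open>B\<close>, it contains as many positions of \<open>A\<close> as it
    misses in \<open>B\<close>.\<close>
  proof (rule sum.reindex_bij_witness[where j = "\<lambda>S. (S \<inter> A, B - S)" and i = "\<lambda>(T, I). T \<union> (B - I)"])
    fix S assume "S \<in> {S. S \<subseteq> A \<union> B \<and> card S = c N}"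
    then have S: "S \<subseteq> A \<union> B" "card S = card B" using cN by auto
    have SS: "S \<inter> A \<union> (B - (B - S)) = S" using S(1) by blast
    then show "(case (S \<inter> A, B - S) of (T, I) \<Rightarrow> T \<union> (B - I)) = S" by simp
    have "S = (S \<inter> A) \<union> (S \<inter> B)" using S(1) by blast
    then have "card S = card (S \<inter> A) + card (S \<inter> B)"
      using card_Un_disjoint[of "S \<inter> A" "S \<inter> B"] fin disj by (metis finite_Int inf_commute
          Int_empty_right inf_assoc inf_left_commute)
    moreover have "card B = card (S \<inter> B) + card (B - S)"
      using card_Int_Diff[OF fin(2), of S] by (simp add: Int_commute)
    ultimately have card: "card (B - S) = card (S \<inter> A)" using S(2) by simp
    then show "(S \<inter> A, B - S) \<in> (SIGMA T:Pow A. {I. I \<subseteq> B \<and> card I = card T})" by auto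
    show "(case (S \<inter> A, B - S) of (T, I) \<Rightarrow> (p * q) ^ card T * ?G T * (\<Prod>j\<in>B - I. w j N)) =
        (\<Prod>j\<in>S. w j N) * word_sum (A \<union> B - S) N w c"
      using main[of "S \<inter> A" "B - S"] card unfolding SS by simp
  next
    fix TI assume "TI \<in> (SIGMA T:Pow A. {I. I \<subseteq> B \<and> card I = card T})"
    then obtain T I where TI: "TI = (T, I)" "T \<subseteq> A" "I \<subseteq> B" "card I = card T" by auto
    have "T \<inter> A = T" "(T \<union> (B - I)) \<inter> A = T" "B - (T \<union> (B - I)) = I"
      using TI disj by auto
    then show "((case TI of (T, I) \<Rightarrow> T \<union> (B - I)) \<inter> A, B - (case TI of (T, I) \<Rightarrow> T \<union> (B - I))) = TI"
      by (simp add: TI(1))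
    have "card (T \<union> (B - I)) = card T + card (B - I)"
      by (rule card_Un_disjoint) (use TI fin disj finite_subset in auto)
    also have "\<dots> = card B"
      using TI fin by (metis card_Diff_subset card_mono finite_subset le_add_diff_inverse)
    finally show "(case TI of (T, I) \<Rightarrow> T \<union> (B - I)) \<in> {S. S \<subseteq> A \<union> B \<and> card S = c N}"
      using TI cN by auto
  qed
  also have "\<dots> = (\<Sum>T\<in>Pow A. \<Sum>I | I \<subseteq> B \<and> card I = card T.
      (p * q) ^ card T * ?G T * (\<Prod>j\<in>B - I. w j N))"
    by (subst sum.Sigma) (use fin in auto)
  finally show ?thesis by (simp add: sum_distrib_left)
qed

section \<open>Eliminating the last block\<close>

fun blk :: "nat list \<Rightarrow> nat \<Rightarrow> nat" where
  "blk [] j = 0"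
| "blk (k # c) j = (if j \<le> sum_list c then blk c j else length c)"

fun blk_first :: "nat list \<Rightarrow> nat \<Rightarrow> bool" where
  "blk_first [] j \<longleftrightarrow> False"
| "blk_first (k # c) j \<longleftrightarrow> (if j \<le> sum_list c then blk_first c j else j = Suc (sum_list c))"

fun blk_size :: "nat list \<Rightarrow> nat \<Rightarrow> nat" where
  "blk_size [] a = 0"
| "blk_size (k # c) a = (if a = length c then k else blk_size c a)"

text \<open>The sum of the weights \<open>t\<close> (excedance letter) and \<open>1\<close> (not an excedance letter) over the
  colors that the letter \<open>a\<close>, a block number, can have at position \<open>j\<close>.\<close>

definition blk_weight :: "'a::comm_ring_1 \<Rightarrow> nat list \<Rightarrow> nat \<Rightarrow> nat \<Rightarrow> 'a" where
  "blk_weight t c j a =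
    (if a < blk c j then t else if a > blk c j then 1 else if blk_first c j then 1 else 1 + t)"

text \<open>The polynomial variable is the parameter \<open>s\<close> added to all weights; the sum
  of interest is the value at \<open>s = 0\<close>. Eliminating a block changes all remaining
  weights by a common summand, which the parameter absorbs.\<close>

definition blk_poly :: "'a::comm_ring_1 \<Rightarrow> nat list \<Rightarrow> 'a poly" where
  "blk_poly t c = word_sum {1..sum_list c} (length c) (\<lambda>j a. [:blk_weight t c j a, 1:]) (blk_size c)"

lemma blk_less: "1 \<le> j \<Longrightarrow> j \<le> sum_list c \<Longrightarrow> blk c j < length c"
  by (induction c) (auto simp: less_Suc_eq)

text \<open>With a second variable \<open>y\<close> and \<open>k > 0\<close> this is
  \<open>(1 + s + y) (1 + t + s + y)^(k - 1)\<close>: the product over a block of size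
  \<open>k\<close> of the weights of its own letter, each increased by \<open>y\<close>. The
  coefficient of \<open>y^i\<close> sums over the choices of \<open>i\<close> positions of the block
  that carry other letters.\<close>

fun loop_poly :: "'a::comm_ring_1 \<Rightarrow> nat \<Rightarrow> 'a poly poly" where
  "loop_poly t 0 = 1"
| "loop_poly t (Suc k) = [:[:1, 1:], 1:] * [:[:1 + t, 1:], 1:] ^ k"

lemma prod_loop_weight:
  "(\<Prod>j\<in>{sum_list c + 1..sum_list c + k}. [:[:blk_weight t (k # c) j (length c), 1:], 1:]) = loop_poly t k"
proof (cases k)
  case (Suc m)
  let ?n = "sum_list c"
  have "{?n + 1..?n + k} = insert (Suc ?n) {?n + 2..?n + k}" using Suc by auto
  then have "(\<Prod>j\<in>{?n + 1..?n + k}. [:[:blk_weight t (k # c) j (length c), 1:], 1:]) =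
      [:[:1, 1:], 1:] * (\<Prod>j\<in>{?n + 2..?n + k}. [:[:blk_weight t (k # c) j (length c), 1:], 1:])"
    by (simp add: blk_weight_def)
  also have "(\<Prod>j\<in>{?n + 2..?n + k}. [:[:blk_weight t (k # c) j (length c), 1:], 1:]) =
      (\<Prod>j\<in>{?n + 2..?n + k}. [:[:1 + t, 1:], 1:])"
    by (rule prod.cong) (auto simp: blk_weight_def)
  finally show ?thesis using Suc by simp
qed simp

text \<open>In the expansion of the product, \<open>I\<close> is the set of the factors that
  contribute the variable.\<close>

lemma sum_subsets_prod_eq_coeff:
  fixes f :: "'b \<Rightarrow> 'a::comm_ring_1"
  assumes "finite B"
  shows "(\<Sum>I | I \<subseteq> B \<and> card I = i. \<Prod>j\<in>B - I. f j) = coeff (\<Prod>j\<in>B. [:f j, 1:]) i"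
proof -
  have "(\<Prod>j\<in>B. [:f j, 1:]) = (\<Prod>j\<in>B. [:0, 1:] + [:f j:])" by simp
  also have "\<dots> = (\<Sum>I\<in>Pow B. (\<Prod>j\<in>I. [:0, 1:]) * (\<Prod>j\<in>B - I. [:f j:]))"
    by (rule prod_add[OF assms])
  also have "\<dots> = (\<Sum>I\<in>Pow B. monom (\<Prod>j\<in>B - I. f j) (card I))"
  proof (rule sum.cong[OF refl])
    fix I assume "I \<in> Pow B"
    have "(\<Prod>j\<in>J. [:f j:]) = [:\<Prod>j\<in>J. f j:]" for J
      by (induction J rule: infinite_finite_induct) (simp_all add: one_pCons)
    then show "(\<Prod>j\<in>I. [:0, 1:]) * (\<Prod>j\<in>B - I. [:f j:]) = monom (\<Prod>j\<in>B - I. f j) (card I)"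
      by (simp add: monom_altdef mult.commute)
  qed
  finally have "coeff (\<Prod>j\<in>B. [:f j, 1:]) i =
      (\<Sum>I\<in>Pow B. if card I = i then \<Prod>j\<in>B - I. f j else 0)"
    by (simp add: coeff_sum)
  also have "\<dots> = (\<Sum>I | I \<in> Pow B \<and> card I = i. \<Prod>j\<in>B - I. f j)"
    by (rule sum.inter_filter[symmetric]) (use assms in simp)
  finally show ?thesis by simp
qed

text \<open>An instance of \<open>word_sum_eliminate\<close>: at the earlier positions the last
  letter has weight \<open>1 + s\<close>, and in the last block all earlier letters have weight
  \<open>t + s\<close>. The positions where the last block carries its own letter give the
  coefficient of \<open>loop_poly\<close>.\<close>

lemma blk_poly_Cons:
  "blk_poly t (k # c) = (\<Sum>T\<in>Pow {1..sum_list c}. ([:t, 1:] * [:1, 1:]) ^ card T *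
     word_sum {1..sum_list c} (length c) (\<lambda>j a. if j \<in> T then 1 else [:blk_weight t c j a, 1:]) (blk_size c) *
     coeff (loop_poly t k) (card T))"
proof -
  let ?A = "{1..sum_list c}" and ?B = "{sum_list c + 1..sum_list c + k}" and ?N = "length c"
  let ?w = "\<lambda>j a. [:blk_weight t (k # c) j a, 1:]"
  have "blk_poly t (k # c) = word_sum (?A \<union> ?B) (Suc ?N) ?w (blk_size (k # c))"
  proof -
    have "{1..sum_list (k # c)} = ?A \<union> ?B" by auto
    then show ?thesis unfolding blk_poly_def by simp
  qed
  also have "\<dots> = (\<Sum>T\<in>Pow ?A. ([:t, 1:] * [:1, 1:]) ^ card T *
      word_sum ?A ?N (\<lambda>j a. if j \<in> T then 1 else ?w j a) (blk_size (k # c)) *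
      (\<Sum>I | I \<subseteq> ?B \<and> card I = card T. \<Prod>j\<in>?B - I. ?w j ?N))"
  proof (rule word_sum_eliminate)
    fix j assume j: "j \<in> ?A"
    then show "?w j ?N = [:1, 1:]" using blk_less[of j c] by (simp add: blk_weight_def)
  qed (auto simp: blk_weight_def)
  also have "\<dots> = (\<Sum>T\<in>Pow ?A. ([:t, 1:] * [:1, 1:]) ^ card T *
      word_sum ?A ?N (\<lambda>j a. if j \<in> T then 1 else [:blk_weight t c j a, 1:]) (blk_size c) *
      coeff (loop_poly t k) (card T))"
  proof (rule sum.cong[OF refl])
    fix T assume "T \<in> Pow ?A"
    have "word_sum ?A ?N (\<lambda>j a. if j \<in> T then 1 else ?w j a) (blk_size (k # c)) =
        word_sum ?A ?N (\<lambda>j a. if j \<in> T then 1 else [:blk_weight t c j a, 1:]) (blk_size c)"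
      by (rule word_sum_cong) (auto simp: blk_weight_def)
    moreover have "(\<Sum>I | I \<subseteq> ?B \<and> card I = card T. \<Prod>j\<in>?B - I. ?w j ?N) = coeff (loop_poly t k) (card T)"
      by (subst sum_subsets_prod_eq_coeff) (simp_all only: prod_loop_weight finite_atLeastAtMost)
    ultimately show "([:t, 1:] * [:1, 1:]) ^ card T *
        word_sum ?A ?N (\<lambda>j a. if j \<in> T then 1 else ?w j a) (blk_size (k # c)) *
        (\<Sum>I | I \<subseteq> ?B \<and> card I = card T. \<Prod>j\<in>?B - I. ?w j ?N) =
      ([:t, 1:] * [:1, 1:]) ^ card T *
        word_sum ?A ?N (\<lambda>j a. if j \<in> T then 1 else [:blk_weight t c j a, 1:]) (blk_size c) *
        coeff (loop_poly t k) (card T)" by simp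
  qed
  finally show ?thesis .
qed

section \<open>Generating functions in the size of the last block\<close>

definition geom :: "'a::comm_ring_1 \<Rightarrow> 'a fps" where
  "geom d = Abs_fps (\<lambda>n. d ^ n)"

lemma geom_nth [simp]: "fps_nth (geom d) n = d ^ n"
  by (simp add: geom_def)

lemma geom_mult: "geom d * (1 - fps_const d * fps_X) = 1"
proof (rule fps_ext)
  fix n
  have "geom d * (1 - fps_const d * fps_X) = geom d - fps_const d * (fps_X * geom d)"
    by (simp only: right_diff_distrib mult_1_right mult_1_left mult_ac)
  then show "fps_nth (geom d * (1 - fps_const d * fps_X)) n = fps_nth 1 n"
    by (cases n) simp_all
qed

text \<open>Summing \<open>loop_poly t k * X^k\<close> over \<open>k\<close> gives
  \<open>(1 - t X) / (1 - (1 + t + s + y) X)\<close>, and the right-hand side is its coefficient of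
  \<open>y^i\<close>. The numerator comes from the first position of a block, where the weight is 1
  instead of \<open>1 + t\<close>.\<close>

lemma loop_poly_gf:
  fixes t :: "'a::comm_ring_1"
  defines "D \<equiv> geom [:1 + t, 1:]"
  shows "Abs_fps (\<lambda>k. coeff (loop_poly t k) i) = (1 - fps_const [:t:] * fps_X) * D * (fps_X * D) ^ i"
proof (induction i)
  case 0
  show ?case
  proof (rule fps_ext)
    fix k
    have eq: "(1 - fps_const [:t:] * fps_X) * D * (fps_X * D) ^ 0 = D - fps_const [:t:] * (fps_X * D)"
      by (simp only: left_diff_distrib mult_1_left mult_1_right power_0 mult.assoc)
    show "fps_nth (Abs_fps (\<lambda>k. coeff (loop_poly t k) 0)) k =
        fps_nth ((1 - fps_const [:t:] * fps_X) * D * (fps_X * D) ^ 0) k"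
    proof (cases k)
      case (Suc m)
      have "[:1, 1:] = [:1 + t, 1:] - [:t:]" by simp
      then have "[:1, 1:] * [:1 + t, 1:] ^ m = [:1 + t, 1:] ^ Suc m - [:t:] * [:1 + t, 1:] ^ m"
        by (simp only: left_diff_distrib power_Suc)
      then show ?thesis unfolding eq Suc
        by (simp only: fps_nth_Abs_fps loop_poly.simps coeff_mult_0 coeff_0_power coeff_pCons_0
            D_def fps_sub_nth fps_mult_left_const_nth fps_X_mult_nth geom_nth) simp
    qed (simp add: eq D_def)
  qed
next
  case (Suc i)
  let ?K = "\<lambda>i. Abs_fps (\<lambda>k. coeff (loop_poly t k) i)"
  let ?d = "[:1 + t, 1:]"
  \<comment> \<open>For \<open>m > 0\<close>, passing from block size \<open>m\<close> to
    \<open>Suc m\<close> multiplies by \<open>1 + t + s + y\<close>. For \<open>m = 0\<close> the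
    factor is \<open>1 + s + y\<close>, which gives the same coefficients of positive powers of
    \<open>y\<close>, the only ones compared here.\<close>
  have "(1 - fps_const ?d * fps_X) * ?K (Suc i) = fps_X * ?K i"
  proof (rule fps_ext)
    fix k
    show "fps_nth ((1 - fps_const ?d * fps_X) * ?K (Suc i)) k = fps_nth (fps_X * ?K i) k"
    proof (cases k)
      case (Suc m)
      have "coeff (loop_poly t (Suc m)) (Suc i) - ?d * coeff (loop_poly t m) (Suc i) = coeff (loop_poly t m) i"
      proof (cases m)
        case (Suc l)
        have "loop_poly t (Suc m) = [:?d, 1:] * loop_poly t m"
          unfolding Suc by (simp only: loop_poly.simps power_Suc mult.left_commute)
        then show ?thesis by (simp add: algebra_simps)
      qed (simp add: coeff_pCons split: nat.split)
      moreover have "(1 - fps_const ?d * fps_X) * ?K (Suc i) = ?K (Suc i) - fps_const ?d * (fps_X * ?K (Suc i))"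
        by (simp only: left_diff_distrib mult_1_left mult.assoc)
      ultimately show ?thesis unfolding Suc by simp
    qed simp
  qed
  then have "D * (1 - fps_const ?d * fps_X) * ?K (Suc i) = fps_X * D * ?K i"
    by (simp only: mult.assoc) (simp only: mult.left_commute)
  then have "?K (Suc i) = fps_X * D * ?K i" unfolding D_def geom_mult by simp
  then show ?case using Suc.IH by (simp only: power_Suc mult_ac)
qed

text \<open>The substitution of \<open>s + u\<close> for \<open>s\<close> in a polynomial in
  \<open>s\<close>. The result is a power series in \<open>X\<close> whose coefficients are again
  polynomials in \<open>s\<close>, so \<open>s\<close> itself appears as
  \<open>fps_const [:0, 1:]\<close>.\<close>

definition fps_eval :: "'a::comm_ring_1 poly fps \<Rightarrow> 'a poly \<Rightarrow> 'a poly fps" where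
  "fps_eval u p = poly (map_poly (\<lambda>r. fps_const [:r:]) p) (fps_const [:0, 1:] + u)"

lemma fps_eval_0: "fps_eval u 0 = 0" and fps_eval_pCons:
  "fps_eval u (pCons a p) = fps_const [:a:] + (fps_const [:0, 1:] + u) * fps_eval u p"
  by (simp_all add: fps_eval_def map_poly_pCons)

lemma fps_eval_add: "fps_eval u (p + q) = fps_eval u p + fps_eval u q"
proof (induction p q rule: poly_induct2)
  case (pCons a p b q)
  have "fps_const [:a + b:] = fps_const [:a:] + fps_const [:b:]" by simp
  then show ?case
    unfolding add_pCons fps_eval_pCons pCons.IH by (simp only: distrib_left add_ac)
qed (simp add: fps_eval_0)

lemma fps_eval_smult: "fps_eval u (smult a q) = fps_const [:a:] * fps_eval u q"
proof (induction q)
  case (pCons b q)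
  show ?case
    unfolding smult_pCons fps_eval_pCons pCons.IH by (simp add: distrib_left mult_ac)
qed (simp add: fps_eval_0)

lemma fps_eval_mult: "fps_eval u (p * q) = fps_eval u p * fps_eval u q"
proof (induction p)
  case (pCons a p)
  have "fps_eval u (pCons a p * q) =
      fps_const [:a:] * fps_eval u q + (fps_const [:0:] + (fps_const [:0, 1:] + u) * fps_eval u (p * q))"
    unfolding mult_pCons_left fps_eval_add fps_eval_smult fps_eval_pCons ..
  also have "\<dots> = fps_eval u (pCons a p) * fps_eval u q"
    unfolding pCons.IH fps_eval_pCons by (simp add: distrib_right mult.assoc)
  finally show ?case .
qed (simp add: fps_eval_0)

lemma fps_eval_const: "fps_eval u [:a:] = fps_const [:a:]"
  by (simp add: fps_eval_0 fps_eval_pCons)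

lemma fps_eval_linear: "fps_eval u [:a, 1:] = fps_const [:a, 1:] + u"
proof -
  have "fps_eval u [:a, 1:] = fps_const [:a:] + (fps_const [:0, 1:] + u) * fps_const 1"
    unfolding fps_eval_pCons fps_eval_0 one_pCons by (simp only: mult_zero_right add_0_right)
  also have "\<dots> = (fps_const [:a:] + fps_const [:0, 1:]) + u"
    by (simp only: fps_const_1_eq_1 mult_1_right add.assoc)
  also have "fps_const [:a:] + fps_const [:0, 1:] = fps_const [:a, 1:]" by simp
  finally show ?thesis .
qed

lemma fps_eval_one: "fps_eval u 1 = 1"
  by (simp add: one_pCons fps_eval_const)

lemma fps_eval_diff: "fps_eval u (p - q) = fps_eval u p - fps_eval u q"
  using fps_eval_add[of u "p - q" q] by simp

lemma fps_eval_power: "fps_eval u (p ^ n) = fps_eval u p ^ n"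
  by (induction n) (simp_all add: fps_eval_one fps_eval_mult)

lemma fps_eval_sum: "fps_eval u (sum f A) = (\<Sum>x\<in>A. fps_eval u (f x))"
  by (induction A rule: infinite_finite_induct) (simp_all add: fps_eval_0 fps_eval_add)

text \<open>Let \<open>u\<close> be the series \<open>(t + s) (1 + s) X D\<close>. By
  \<open>loop_poly_gf\<close>, a set \<open>T\<close> in \<open>blk_poly_Cons\<close> contributes
  \<open>u ^ card T\<close>, up to the common factor \<open>(1 - t X) D\<close>. By
  \<open>word_sum_add_const\<close>, summing over \<open>T\<close> then amounts to adding
  \<open>u\<close> to all weights, that is, to substituting \<open>s + u\<close> for
  \<open>s\<close>.\<close>

lemma blk_poly_Cons_gf:
  fixes t :: "'a::comm_ring_1" and c :: "nat list"
  defines "D \<equiv> geom [:1 + t, 1:]"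
  shows "Abs_fps (\<lambda>k. blk_poly t (k # c)) = (1 - fps_const [:t:] * fps_X) * D *
    fps_eval (fps_const ([:t, 1:] * [:1, 1:]) * (fps_X * D)) (blk_poly t c)"
proof -
  let ?A = "{1..sum_list c}" and ?N = "length c" and ?pq = "[:t, 1:] * [:1, 1:] :: 'a poly"
  let ?Q = "(1 - fps_const [:t:] * fps_X) * D"
  let ?u = "fps_const ?pq * (fps_X * D)"
  let ?w = "\<lambda>j a. [:blk_weight t c j a, 1:]"
  let ?G = "\<lambda>T. word_sum ?A ?N (\<lambda>j a. if j \<in> T then 1 else ?w j a) (blk_size c)"
  have hom: "fps_const (word_sum X N w c) = word_sum X N (\<lambda>j a. fps_const (w j a)) c"
    for X N and w :: "nat \<Rightarrow> nat \<Rightarrow> 'a poly" and c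
    by (rule word_sum_hom) simp_all
  have "fps_eval ?u (blk_poly t c) = word_sum ?A ?N (\<lambda>j a. fps_eval ?u (?w j a)) (blk_size c)"
    unfolding blk_poly_def
    by (rule word_sum_hom) (simp_all only: fps_eval_0 fps_eval_one fps_eval_add fps_eval_mult)
  also have "\<dots> = word_sum ?A ?N (\<lambda>j a. fps_const (?w j a) + ?u) (blk_size c)"
    by (simp only: fps_eval_linear)
  also have "\<dots> = (\<Sum>T\<in>Pow ?A. ?u ^ card T *
      word_sum ?A ?N (\<lambda>j a. if j \<in> T then 1 else fps_const (?w j a)) (blk_size c))"
    by (rule word_sum_add_const) simp
  also have "\<dots> = (\<Sum>T\<in>Pow ?A. ?u ^ card T * fps_const (?G T))"
    by (simp only: hom if_distrib[of fps_const] fps_const_1_eq_1)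
  finally have eval: "fps_eval ?u (blk_poly t c) = (\<Sum>T\<in>Pow ?A. ?u ^ card T * fps_const (?G T))" .
  have "Abs_fps (\<lambda>k. blk_poly t (k # c)) =
      (\<Sum>T\<in>Pow ?A. fps_const (?pq ^ card T * ?G T) * Abs_fps (\<lambda>k. coeff (loop_poly t k) (card T)))"
    by (rule fps_ext) (simp only: blk_poly_Cons fps_nth_Abs_fps fps_sum_nth fps_mult_left_const_nth)
  also have "\<dots> = (\<Sum>T\<in>Pow ?A. ?Q * (?u ^ card T * fps_const (?G T)))"
    unfolding loop_poly_gf D_def[symmetric]
    by (rule sum.cong[OF refl])
      (simp only: power_mult_distrib fps_const_mult[symmetric] fps_const_power[symmetric] mult_ac)
  finally show ?thesis by (simp only: eval sum_distrib_left)
qed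

text \<open>Index sets of convolutions: summing over the splittings of \<open>c\<close> into
  \<open>vec_diff c e\<close> and \<open>e\<close> corresponds to multiplying generating functions
  with one variable for each block.\<close>

definition subvecs :: "nat list \<Rightarrow> nat list set" where
  "subvecs c = {e. list_all2 (\<le>) e c}"

definition vec_diff :: "nat list \<Rightarrow> nat list \<Rightarrow> nat list" where
  "vec_diff c e = map2 (-) c e"

lemma subvecs_Nil [simp]: "subvecs [] = {[]}"
  by (auto simp: subvecs_def)

lemma subvecs_Cons: "subvecs (k # c) = (\<lambda>(j, e). j # e) ` ({..k} \<times> subvecs c)"
  by (force simp: subvecs_def list_all2_Cons2 image_iff)

lemma finite_subvecs [simp]: "finite (subvecs c)"
  by (induction c) (simp_all add: subvecs_Cons)

lemma sum_subvecs_Cons: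
  "(\<Sum>e\<in>subvecs (k # c). g e) = (\<Sum>e\<in>subvecs c. \<Sum>j\<le>k. g (j # e))"
proof -
  have "(\<Sum>e\<in>subvecs (k # c). g e) = (\<Sum>(j, e)\<in>{..k} \<times> subvecs c. g (j # e))"
    unfolding subvecs_Cons by (subst sum.reindex) (auto simp: inj_on_def case_prod_unfold)
  also have "\<dots> = (\<Sum>j\<le>k. \<Sum>e\<in>subvecs c. g (j # e))"
    by (rule sum.cartesian_product[symmetric])
  finally show ?thesis by (simp add: sum.swap[of _ "subvecs c"])
qed

lemma vec_diff_Nil [simp]: "vec_diff [] [] = []"
  by (simp add: vec_diff_def)

lemma vec_diff_Cons [simp]: "vec_diff (k # c) (j # e) = (k - j) # vec_diff c e"
  by (simp add: vec_diff_def)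

text \<open>In generating function terms, with \<open>H(x) = \<Prod>\<^sub>a 1 / (1 - x\<^sub>a)\<close>, this says
  \<open>P(s) ((1 + s) H(t x) - (t + s) H(x)) = (1 - t) H(x)\<close>. Eliminating the last block amounts to
  substituting \<open>s + (t + s) (1 + s) X D\<close> for \<open>s\<close>, which rescales \<open>1 + s\<close> by \<open>(1 - X) D\<close>
  and \<open>t + s\<close> by \<open>(1 - t X) D\<close>.\<close>

lemma blk_poly_identity:
  fixes t :: "'a::comm_ring_1"
  shows "(\<Sum>e\<in>subvecs c. blk_poly t (vec_diff c e) * ([:1, 1:] * [:t:] ^ sum_list e - [:t, 1:])) = [:1 - t:]"
proof (induction c)
  case Nil
  have "words_on {} 0 (blk_size []) = {\<lambda>_. undefined}" by (auto simp: words_on_def)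
  then show ?case by (simp add: blk_poly_def word_sum_def)
next
  case (Cons k c)
  let ?q = "[:1, 1:] :: 'a poly" and ?p = "[:t, 1:]" and ?t = "[:t:]"
  define D where "D = geom [:1 + t, 1:]"
  define u where "u = fps_const (?p * ?q) * (fps_X * D)"
  define Q P T where "Q = fps_const ?q" and "P = fps_const ?p" and "T = fps_const ?t"
  define H where "H e = fps_eval u (blk_poly t (vec_diff c e))" for e
  define F where "F e = Abs_fps (\<lambda>k. blk_poly t (k # vec_diff c e))" for e
  have F: "F e = (1 - T * fps_X) * D * H e" for e
    unfolding F_def H_def u_def D_def T_def by (rule blk_poly_Cons_gf)
  have D1: "D * (1 - (1 + P) * fps_X) = 1"
  proof -
    have "fps_const [:1 + t, 1:] = 1 + P"
      unfolding P_def by (metis add_pCons add_0 fps_const_1_eq_1 fps_const_add one_pCons)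
    then show ?thesis using geom_mult[of "[:1 + t, 1:]"] by (simp add: D_def)
  qed
  have QP: "Q + T = 1 + P"
    by (simp add: Q_def P_def T_def one_pCons flip: fps_const_1_eq_1)
  have Qu: "Q + u = Q * D * (1 - fps_X)"
  proof -
    have "Q + u = Q * (D * (1 - (1 + P) * fps_X)) + P * Q * (fps_X * D)"
      unfolding D1 by (simp add: u_def P_def Q_def)
    then show ?thesis by (simp add: algebra_simps)
  qed
  have Pu: "P + u = P * D * (1 - T * fps_X)"
  proof -
    have "P + u = P * (D * (1 - (Q + T) * fps_X)) + P * Q * (fps_X * D)"
      unfolding QP D1 by (simp add: u_def P_def Q_def)
    then show ?thesis by (simp add: algebra_simps)
  qed
  \<comment> \<open>The induction hypothesis with \<open>s + u\<close> in place of \<open>s\<close>,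
    by which \<open>1 + s\<close> and \<open>t + s\<close> become \<open>Q + u\<close> and
    \<open>P + u\<close>.\<close>
  have IH: "(\<Sum>e\<in>subvecs c. H e * ((Q + u) * T ^ sum_list e - (P + u))) = fps_const [:1 - t:]"
    using arg_cong[OF Cons.IH, of "fps_eval u"]
    unfolding fps_eval_sum fps_eval_mult fps_eval_diff fps_eval_power fps_eval_linear fps_eval_const
      H_def Q_def P_def T_def .
  have GT: "geom ?t * (1 - T * fps_X) = 1"
    using geom_mult[of ?t] by (simp add: T_def)
  have G1: "geom 1 * (1 - fps_X) = (1 :: 'a poly fps)"
    using geom_mult[of "1 :: 'a poly"] by simp
  \<comment> \<open>The coefficient of \<open>X^j\<close> in \<open>?B e\<close> is the bracket of
    the claim for the vector \<open>j # e\<close>. So multiplication by \<open>F e\<close> performs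
    the summation over the component \<open>j\<close> of the last block.\<close>
  let ?B = "\<lambda>e. Q * T ^ sum_list e * geom ?t - P * geom 1"
  have "(\<Sum>e\<in>subvecs c. ?B e * F e) = (\<Sum>e\<in>subvecs c. geom 1 * (H e * ((Q + u) * T ^ sum_list e - (P + u))))"
  proof (rule sum.cong[OF refl])
    fix e :: "nat list"
    let ?n = "sum_list e"
    \<comment> \<open>The factor \<open>1 - t X\<close> of \<open>F e\<close> cancels
      \<open>geom ?t\<close>. The 1 left in its place is rewritten as
      \<open>geom 1 * (1 - X)\<close>, so that \<open>Qu\<close> and \<open>Pu\<close> apply and
      both terms share the factor \<open>geom 1\<close>.\<close>
    have "?B e * F e = (Q * T ^ ?n * (geom ?t * (1 - T * fps_X)) * 1 - P * geom 1 * (1 - T * fps_X)) * D * H e"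
      unfolding F by (simp add: algebra_simps)
    also have "\<dots> = (Q * T ^ ?n * (geom 1 * (1 - fps_X)) - P * geom 1 * (1 - T * fps_X)) * D * H e"
      unfolding GT G1 by simp
    also have "\<dots> = geom 1 * (H e * ((Q + u) * T ^ ?n - (P + u)))"
      unfolding Qu Pu by (simp add: algebra_simps)
    finally show "?B e * F e = geom 1 * (H e * ((Q + u) * T ^ ?n - (P + u)))" .
  qed
  also have "\<dots> = geom 1 * fps_const [:1 - t:]"
    unfolding IH[symmetric] by (rule sum_distrib_left[symmetric])
  finally have "fps_nth (\<Sum>e\<in>subvecs c. ?B e * F e) k = fps_nth (geom 1 * fps_const [:1 - t:]) k" by simp
  moreover have "fps_nth (?B e * F e) k =
      (\<Sum>j\<le>k. blk_poly t ((k - j) # vec_diff c e) * (?q * ?t ^ (j + sum_list e) - ?p))" for e :: "nat list"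
  proof -
    have "fps_nth (?B e) j = ?q * ?t ^ (j + sum_list e) - ?p" for j
    proof -
      have "Q * T ^ sum_list e = fps_const (?q * ?t ^ sum_list e)"
        unfolding Q_def T_def by (simp only: fps_const_mult fps_const_power)
      then show ?thesis unfolding P_def
        by (simp only: fps_sub_nth fps_mult_left_const_nth geom_nth power_one mult_1_right power_add mult.assoc)
          (simp only: mult.commute)
    qed
    then show ?thesis
      unfolding fps_mult_nth F_def fps_nth_Abs_fps atMost_atLeast0 by (simp only: mult.commute)
  qed
  ultimately show ?case
    unfolding sum_subvecs_Cons by (simp add: fps_sum_nth)
qed

section \<open>Permutations as colored words\<close>

definition rank_on :: "'a set \<Rightarrow> ('a \<Rightarrow> nat) \<Rightarrow> 'a \<Rightarrow> nat" where
  "rank_on X key x = card {y \<in> X. key y \<le> key x}"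

lemma rank_on_less_iff:
  assumes "finite X" "x \<in> X" "y \<in> X"
  shows "rank_on X key x < rank_on X key y \<longleftrightarrow> key x < key y"
proof -
  have lt: "rank_on X key x < rank_on X key y" if "key x < key y" "y \<in> X" for x y
    unfolding rank_on_def
  proof (rule psubset_card_mono)
    show "{z \<in> X. key z \<le> key x} \<subset> {z \<in> X. key z \<le> key y}"
      using that by (auto simp: psubset_eq set_eq_iff) (metis le_refl not_le)
  qed (use assms in simp)
  have le: "rank_on X key y \<le> rank_on X key x" if "key y \<le> key x" for x y
    unfolding rank_on_def using assms(1) that by (intro card_mono) auto
  show ?thesis using lt[of x y] le[of y x] assms by (meson not_le)
qed

lemma bij_betw_rank_on:
  assumes "finite X" "inj_on key X"
  shows "bij_betw (rank_on X key) X {1..card X}"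
proof -
  have inj: "inj_on (rank_on X key) X"
  proof (rule inj_onI)
    fix x y assume xy: "x \<in> X" "y \<in> X" "rank_on X key x = rank_on X key y"
    then have "key x = key y"
      using rank_on_less_iff[OF assms(1), of x y key] rank_on_less_iff[OF assms(1), of y x key] by simp
    then show "x = y" using assms(2) xy by (auto dest: inj_onD)
  qed
  have "rank_on X key ` X \<subseteq> {1..card X}"
  proof
    fix r assume "r \<in> rank_on X key ` X"
    then obtain x where x: "x \<in> X" "r = rank_on X key x" by blast
    have "card {x} \<le> r" unfolding x(2) rank_on_def using assms(1) x(1) by (intro card_mono) auto
    moreover have "r \<le> card X" unfolding x(2) rank_on_def using assms(1) by (intro card_mono) auto
    ultimately show "r \<in> {1..card X}" by simp
  qed
  then have "rank_on X key ` X = {1..card X}"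
    by (intro card_subset_eq) (simp_all add: card_image[OF inj])
  then show ?thesis using inj by (simp add: bij_betw_def)
qed

text \<open>Used to identify positions with ranks. Since \<open>f\<close> and \<open>key\<close>
  order \<open>X\<close> alike, \<open>f\<close> maps the elements with key at most
  \<open>key x\<close> onto \<open>{1..f x}\<close>.\<close>

lemma rank_on_unique:
  assumes "bij_betw f X {1..card X}" "finite X"
    and mono: "\<And>x y. x \<in> X \<Longrightarrow> y \<in> X \<Longrightarrow> f x < f y \<Longrightarrow> key x < key y" and "x \<in> X"
  shows "rank_on X key x = f x"
proof -
  have inj: "inj_on f X" and im: "f ` X = {1..card X}" using assms(1) by (auto simp: bij_betw_def)
  have iff: "key y \<le> key x \<longleftrightarrow> f y \<le> f x" if "y \<in> X" for y
  proof
    assume "key y \<le> key x"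
    then show "f y \<le> f x" using mono[of x y] that assms(4) by (meson not_le)
  next
    assume "f y \<le> f x"
    then consider "f y < f x" | "f y = f x" by linarith
    then show "key y \<le> key x"
    proof cases
      case 1
      then show ?thesis using mono[of y x] that assms(4) by simp
    next
      case 2
      then have "y = x" using inj that assms(4) by (auto dest: inj_onD)
      then show ?thesis by simp
    qed
  qed
  have "f x \<in> {1..card X}" using im assms(4) by blast
  have "f ` {y \<in> X. key y \<le> key x} = {1..f x}"
  proof (intro set_eqI iffI)
    fix r assume "r \<in> f ` {y \<in> X. key y \<le> key x}"
    then show "r \<in> {1..f x}" using iff im by auto
  next
    fix r assume r: "r \<in> {1..f x}"
    then have "r \<in> f ` X" using im \<open>f x \<in> {1..card X}\<close> by auto
    then obtain y where "y \<in> X" "r = f y" by blast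
    then show "r \<in> f ` {y \<in> X. key y \<le> key x}" using iff r by auto
  qed
  then have "card {y \<in> X. key y \<le> key x} = card {1..f x}"
    using card_image[OF inj_on_subset[OF inj], of "{y \<in> X. key y \<le> key x}"] by auto
  then show ?thesis by (simp add: rank_on_def)
qed

section \<open>Block numbers of positions\<close>

lemma blk_mono: "1 \<le> i \<Longrightarrow> i \<le> j \<Longrightarrow> j \<le> sum_list c \<Longrightarrow> blk c i \<le> blk c j"
proof (induction c)
  case (Cons k c)
  then show ?case using blk_less[of i c] by auto
qed simp

lemma blk_first_iff:
  "1 \<le> j \<Longrightarrow> j \<le> sum_list c \<Longrightarrow> blk_first c j \<longleftrightarrow> (\<forall>i. 1 \<le> i \<and> i < j \<longrightarrow> blk c i < blk c j)"
proof (induction c)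
  case (Cons k c)
  show ?case
  proof (cases "j \<le> sum_list c")
    case True
    then show ?thesis using Cons by auto
  next
    case False
    have "blk_first (k # c) j \<longleftrightarrow> (\<forall>i. 1 \<le> i \<and> i < j \<longrightarrow> i \<le> sum_list c)"
    proof
      assume "\<forall>i. 1 \<le> i \<and> i < j \<longrightarrow> i \<le> sum_list c"
      then have "\<not> (Suc (sum_list c) < j)" by (auto dest: spec[of _ "Suc (sum_list c)"])
      then show "blk_first (k # c) j" using False by simp
    qed (use False in auto)
    also have "\<dots> \<longleftrightarrow> (\<forall>i. 1 \<le> i \<and> i < j \<longrightarrow> blk (k # c) i < blk (k # c) j)"
    proof -
      have "i \<le> sum_list c \<longleftrightarrow> blk (k # c) i < blk (k # c) j" if "1 \<le> i" for i
        using False that blk_less[of i c] by simp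
      then show ?thesis by blast
    qed
    finally show ?thesis .
  qed
qed simp

lemma card_blk_eq:
  "a < length c \<Longrightarrow> card {i \<in> {1..sum_list c}. blk c i = a} = blk_size c a"
proof (induction c)
  case (Cons k c)
  show ?case
  proof (cases "a = length c")
    case True
    have "{i \<in> {1..sum_list (k # c)}. blk (k # c) i = a} = {sum_list c + 1..sum_list c + k}"
      using True blk_less[of _ c] by (force simp: not_le)
    then show ?thesis using True by simp
  next
    case False
    then have "{i \<in> {1..sum_list (k # c)}. blk (k # c) i = a} = {i \<in> {1..sum_list c}. blk c i = a}"
      by (auto split: if_splits)
    then show ?thesis using False Cons by simp
  qed
qed simp

text \<open>Replaces the recursion over blocks by a condition on pairs of positions, the form suited
  to permutations. Positions on different sides of \<open>sum_list c\<close> have different block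
  numbers, so such pairs impose nothing.\<close>

lemma bsorted_iff_blk:
  "bsorted c w \<longleftrightarrow> length w = sum_list c \<and>
    (\<forall>i j. 1 \<le> i \<and> i < j \<and> j \<le> sum_list c \<and> blk c i = blk c j \<longrightarrow> w ! (i - 1) \<le> w ! (j - 1))"
proof (induction c arbitrary: w)
  case (Cons k c)
  let ?n = "sum_list c"
  show ?case
  proof (cases "length w = ?n + k")
    case len: True
    let ?P = "\<lambda>i j. 1 \<le> i \<and> i < j \<and> j \<le> ?n + k \<and> blk (k # c) i = blk (k # c) j \<longrightarrow> w ! (i - 1) \<le> w ! (j - 1)"
    have 1: "bsorted c (take ?n w) \<longleftrightarrow> (\<forall>i j. j \<le> ?n \<longrightarrow> ?P i j)"
    proof -
      have "(1 \<le> i \<and> i < j \<and> j \<le> ?n \<and> blk c i = blk c j \<longrightarrow> take ?n w ! (i - 1) \<le> take ?n w ! (j - 1)) \<longleftrightarrow>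
          (j \<le> ?n \<longrightarrow> ?P i j)" for i j
      proof (cases "1 \<le> i \<and> i < j \<and> j \<le> ?n")
        case True
        then have "take ?n w ! (i - 1) = w ! (i - 1)" "take ?n w ! (j - 1) = w ! (j - 1)" by auto
        then show ?thesis using True by simp
      qed auto
      then show ?thesis unfolding Cons.IH using len by simp
    qed
    have 2: "sorted (drop ?n w) \<longleftrightarrow> (\<forall>i j. i > ?n \<longrightarrow> ?P i j)"
    proof
      assume s: "sorted (drop ?n w)"
      show "\<forall>i j. i > ?n \<longrightarrow> ?P i j"
      proof (intro allI impI)
        fix i j assume "?n < i" "1 \<le> i \<and> i < j \<and> j \<le> ?n + k \<and> blk (k # c) i = blk (k # c) j"
        then have "?n < i" "i < j" "j \<le> ?n + k" by auto
        then have "i - 1 - ?n \<le> j - 1 - ?n" "j - 1 - ?n < length (drop ?n w)"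
          "i - 1 = ?n + (i - 1 - ?n)" "j - 1 = ?n + (j - 1 - ?n)" using len by auto
        then show "w ! (i - 1) \<le> w ! (j - 1)"
          using sorted_nth_mono[OF s, of "i - 1 - ?n" "j - 1 - ?n"] len by (metis nth_drop le_add1)
      qed
    next
      assume P: "\<forall>i j. i > ?n \<longrightarrow> ?P i j"
      show "sorted (drop ?n w)"
        unfolding sorted_iff_nth_Suc
      proof (intro allI impI)
        fix i assume "Suc i < length (drop ?n w)"
        then show "drop ?n w ! i \<le> drop ?n w ! Suc i"
          using P[rule_format, of "?n + i + 1" "?n + i + 2"] len by simp
      qed
    qed
    have mixed: "?P i j" if "i \<le> ?n" "?n < j" for i j
      using that blk_less[of i c] by auto
    have "bsorted (k # c) w \<longleftrightarrow> (\<forall>i j. j \<le> ?n \<longrightarrow> ?P i j) \<and> (\<forall>i j. i > ?n \<longrightarrow> ?P i j)"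
      using len 1 2 by simp
    also have "\<dots> \<longleftrightarrow> (\<forall>i j. ?P i j)"
    proof (intro iffI allI)
      fix i j assume *: "(\<forall>i j. j \<le> ?n \<longrightarrow> ?P i j) \<and> (\<forall>i j. i > ?n \<longrightarrow> ?P i j)"
      consider "j \<le> ?n" | "i > ?n" | "i \<le> ?n" "?n < j" by linarith
      then show "?P i j"
      proof cases
        case 1
        then show ?thesis using * by blast
      next
        case 2
        then show ?thesis using * by blast
      next
        case 3
        then show ?thesis by (rule mixed)
      qed
    qed blast
    finally show ?thesis using len by (simp add: add.commute)
  next
    case False
    then show ?thesis by (simp add: add.commute)
  qed
qed auto

section \<open>Colored words\<close>

lemma card_less_eq_sum:
  fixes f :: "'a \<Rightarrow> nat"
  assumes "finite X"
  shows "card {x \<in> X. f x < a} = (\<Sum>b<a. card {x \<in> X. f x = b})"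
proof (induction a)
  case (Suc a)
  have "{x \<in> X. f x < Suc a} = {x \<in> X. f x < a} \<union> {x \<in> X. f x = a}" by auto
  also have "card \<dots> = card {x \<in> X. f x < a} + card {x \<in> X. f x = a}"
    by (rule card_Un_disjoint) (use assms in auto)
  finally show ?case using Suc by simp
qed simp

text \<open>For a permutation, \<open>v j\<close> is the block of the position of the value
  \<open>j\<close>, and \<open>E\<close> is the set of excedance letters, those \<open>j\<close>
  with \<open>inv \<sigma> j < j\<close>. If \<open>j\<close> and its position lie in different
  blocks, the order of the blocks decides whether \<open>j\<close> is in \<open>E\<close>. In the
  same block, \<open>j\<close> is forced out of \<open>E\<close> only if it is the first position
  there.\<close>

definition color_ok :: "nat list \<Rightarrow> (nat \<Rightarrow> nat) \<Rightarrow> nat set \<Rightarrow> bool" where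
  "color_ok c v E \<longleftrightarrow> E \<subseteq> {1..sum_list c} \<and> (\<forall>j\<in>{1..sum_list c}.
     (v j < blk c j \<longrightarrow> j \<in> E) \<and> (v j > blk c j \<longrightarrow> j \<notin> E) \<and> (v j = blk c j \<and> blk_first c j \<longrightarrow> j \<notin> E))"

text \<open>The lexicographic order by block, membership in \<open>E\<close> (members first) and
  value, packed into one number. The base \<open>Suc n\<close> exceeds all values
  \<open>j\<close>.\<close>

definition color_key :: "nat \<Rightarrow> (nat \<Rightarrow> nat) \<Rightarrow> nat set \<Rightarrow> nat \<Rightarrow> nat" where
  "color_key n v E j = (2 * v j + (if j \<in> E then 0 else 1)) * Suc n + j"

lemma color_key_less_iff:
  assumes "i \<in> {1..n}" "j \<in> {1..n}"
  shows "color_key n v E i < color_key n v E j \<longleftrightarrow>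
    v i < v j \<or> v i = v j \<and> (i \<in> E \<and> j \<notin> E \<or> (i \<in> E \<longleftrightarrow> j \<in> E) \<and> i < j)"
proof -
  let ?x = "\<lambda>j. 2 * v j + (if j \<in> E then 0 else 1)"
  have lt: "x * Suc n + a < y * Suc n + b" if "x < y" "a \<le> n" for x y a b :: nat
  proof -
    have "x * Suc n + a < Suc x * Suc n" using that(2) by simp
    also have "\<dots> \<le> y * Suc n" using that(1) by (intro mult_le_mono1) simp
    finally show ?thesis by simp
  qed
  have "color_key n v E i < color_key n v E j \<longleftrightarrow> ?x i < ?x j \<or> ?x i = ?x j \<and> i < j"
    using lt[of "?x i" "?x j" i j] lt[of "?x j" "?x i" j i] assms
    unfolding color_key_def by (cases "?x i" "?x j" rule: linorder_cases) (simp_all del: mult_Suc_right)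
  also have "\<dots> \<longleftrightarrow> v i < v j \<or> v i = v j \<and> (i \<in> E \<and> j \<notin> E \<or> (i \<in> E \<longleftrightarrow> j \<in> E) \<and> i < j)"
    by (cases "i \<in> E"; cases "j \<in> E"; simp; arith)
  finally show ?thesis .
qed

lemma inj_on_color_key: "inj_on (color_key n v E) {1..n}"
proof (rule inj_onI)
  fix i j assume ij: "i \<in> {1..n}" "j \<in> {1..n}" "color_key n v E i = color_key n v E j"
  then show "i = j"
    using color_key_less_iff[OF ij(1,2), of v E] color_key_less_iff[OF ij(2,1), of v E]
    by (metis less_irrefl linorder_neqE_nat)
qed

definition exc_coloring :: "nat list \<Rightarrow> (nat \<Rightarrow> nat) \<Rightarrow> (nat \<Rightarrow> nat) \<times> nat set" where
  "exc_coloring c \<sigma> = (restrict (\<lambda>j. blk c (inv \<sigma> j)) {1..sum_list c}, {j \<in> {1..sum_list c}. inv \<sigma> j < j})"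

definition colored_words :: "nat list \<Rightarrow> ((nat \<Rightarrow> nat) \<times> nat set) set" where
  "colored_words c = (SIGMA v:words_on {1..sum_list c} (length c) (blk_size c). {E. color_ok c v E})"

lemma nth_bar_word:
  "1 \<le> i \<Longrightarrow> i \<le> n \<Longrightarrow> bar_word n \<sigma> ! (i - 1) = \<sigma> i + (if \<sigma> i > i then 0 else n)"
  by (cases i) (simp_all add: bar_word_def nth_upt del: upt_Suc)

lemma bsorted_bar_word_iff:
  fixes c :: "nat list"
  defines "n \<equiv> sum_list c"
  shows "bsorted c (bar_word n \<sigma>) \<longleftrightarrow> (\<forall>i j. 1 \<le> i \<and> i < j \<and> j \<le> n \<and> blk c i = blk c j \<longrightarrow>
    \<sigma> i + (if \<sigma> i > i then 0 else n) \<le> \<sigma> j + (if \<sigma> j > j then 0 else n))"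
proof -
  have "bar_word n \<sigma> ! (i - 1) \<le> bar_word n \<sigma> ! (j - 1) \<longleftrightarrow>
      \<sigma> i + (if \<sigma> i > i then 0 else n) \<le> \<sigma> j + (if \<sigma> j > j then 0 else n)"
    if "1 \<le> i" "i < j" "j \<le> n" for i j
    using that nth_bar_word[of i n \<sigma>] nth_bar_word[of j n \<sigma>] by (simp del: One_nat_def)
  then show ?thesis unfolding bsorted_iff_blk length_bar_word n_def[symmetric] by blast
qed

lemma inv_in_range:
  assumes "\<sigma> permutes {1..n}"
  shows "j \<in> {1..n} \<Longrightarrow> inv \<sigma> j \<in> {1..n}"
  using permutes_in_image[OF permutes_inv[OF assms], of j] by simp

lemma exc_coloring_in:
  assumes \<sigma>: "\<sigma> permutes {1..sum_list c}"
  shows "exc_coloring c \<sigma> \<in> colored_words c"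
proof -
  let ?X = "{1..sum_list c}"
  let ?v = "restrict (\<lambda>j. blk c (inv \<sigma> j)) ?X"
  note r = inv_in_range[OF \<sigma>]
  have "card {j \<in> ?X. ?v j = a} = blk_size c a" if "a < length c" for a
  proof -
    have "bij_betw (inv \<sigma>) {j \<in> ?X. ?v j = a} {i \<in> ?X. blk c i = a}"
    proof (rule bij_betw_subset[OF permutes_imp_bij[OF permutes_inv[OF \<sigma>]]])
      show "inv \<sigma> ` {j \<in> ?X. ?v j = a} = {i \<in> ?X. blk c i = a}"
      proof (intro set_eqI iffI)
        fix i assume "i \<in> inv \<sigma> ` {j \<in> ?X. ?v j = a}"
        then obtain j where "j \<in> ?X" "?v j = a" "i = inv \<sigma> j" by blast
        then show "i \<in> {i \<in> ?X. blk c i = a}" using r[of j] by auto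
      next
        fix i assume "i \<in> {i \<in> ?X. blk c i = a}"
        then have i: "i \<in> ?X" "blk c i = a" by auto
        then have "\<sigma> i \<in> ?X" "inv \<sigma> (\<sigma> i) = i"
          using permutes_in_image[OF \<sigma>, of i] permutes_inverses(2)[OF \<sigma>] by auto
        then show "i \<in> inv \<sigma> ` {j \<in> ?X. ?v j = a}" using i by (intro image_eqI[of _ _ "\<sigma> i"]) auto
      qed
    qed auto
    from bij_betw_same_card[OF this] show ?thesis using card_blk_eq[OF that] by simp
  qed
  moreover have "blk c (inv \<sigma> j) < length c" if "j \<in> ?X" for j
    using r[OF that] blk_less[of "inv \<sigma> j" c] by simp
  ultimately have "?v \<in> words_on ?X (length c) (blk_size c)"
    by (auto simp: words_on_def)
  moreover have "color_ok c ?v {j \<in> ?X. inv \<sigma> j < j}"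
    unfolding color_ok_def
  proof (intro conjI ballI impI)
    fix j assume j: "j \<in> ?X"
    note rj = r[OF j]
    { assume "?v j < blk c j"
      then have "\<not> j \<le> inv \<sigma> j" using blk_mono[of j "inv \<sigma> j" c] j rj by auto
      then show "j \<in> {j \<in> ?X. inv \<sigma> j < j}" using j by auto }
    { assume "?v j > blk c j"
      then have "\<not> inv \<sigma> j \<le> j" using blk_mono[of "inv \<sigma> j" j c] j rj by auto
      then show "j \<notin> {j \<in> ?X. inv \<sigma> j < j}" by auto }
    { assume "?v j = blk c j \<and> blk_first c j"
      then have "\<not> inv \<sigma> j < j" using blk_first_iff[of j c] j rj by auto
      then show "j \<notin> {j \<in> ?X. inv \<sigma> j < j}" by auto }
  qed auto
  ultimately show ?thesis by (simp add: exc_coloring_def colored_words_def)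
qed

text \<open>Within a block, a sorted barred word lists first the excedance letters and then the
  others, each kind increasingly. This is the order of \<open>color_key\<close>, so the position of
  a value is its rank, and the coloring determines \<open>\<sigma>\<close>.\<close>

lemma inv_eq_rank_on:
  assumes \<sigma>: "\<sigma> permutes {1..sum_list c}" and sorted: "bsorted c (bar_word (sum_list c) \<sigma>)"
    and vE: "exc_coloring c \<sigma> = (v, E)" and x: "x \<in> {1..sum_list c}"
  shows "rank_on {1..sum_list c} (color_key (sum_list c) v E) x = inv \<sigma> x"
proof (rule rank_on_unique)
  let ?X = "{1..sum_list c}"
  show "bij_betw (inv \<sigma>) ?X {1..card ?X}" using permutes_imp_bij[OF permutes_inv[OF \<sigma>]] by simp
  fix x y assume xy: "x \<in> ?X" "y \<in> ?X" "inv \<sigma> x < inv \<sigma> y"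
  note r = inv_in_range[OF \<sigma> xy(1)] inv_in_range[OF \<sigma> xy(2)]
  have v: "v x = blk c (inv \<sigma> x)" "v y = blk c (inv \<sigma> y)" and E: "x \<in> E \<longleftrightarrow> inv \<sigma> x < x" "y \<in> E \<longleftrightarrow> inv \<sigma> y < y"
    using vE xy(1,2) by (auto simp: exc_coloring_def)
  have s: "\<sigma> (inv \<sigma> x) = x" "\<sigma> (inv \<sigma> y) = y" using permutes_inverses(1)[OF \<sigma>] by auto
  have "v x \<le> v y" unfolding v using xy(3) r by (intro blk_mono) auto
  moreover have "x \<in> E \<and> y \<notin> E \<or> (x \<in> E \<longleftrightarrow> y \<in> E) \<and> x < y" if "v x = v y"
  proof -
    have "x + (if x > inv \<sigma> x then 0 else sum_list c) \<le> y + (if y > inv \<sigma> y then 0 else sum_list c)"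
      using sorted[unfolded bsorted_bar_word_iff, rule_format, of "inv \<sigma> x" "inv \<sigma> y"] xy(3) r that
      unfolding s v by simp
    moreover have "x \<noteq> y" using xy(3) by auto
    ultimately show ?thesis using E xy(1,2) by (auto split: if_splits)
  qed
  ultimately show "color_key (sum_list c) v E x < color_key (sum_list c) v E y"
    unfolding color_key_less_iff[OF xy(1,2)] by (cases "v x = v y") auto
qed (use x in simp_all)

text \<open>Monotonicity of \<open>blk c\<close> puts the blocks before \<open>a\<close> in front.
  Statements on blocks thus become inequalities between positions and counts.\<close>

lemma blk_initial_segment:
  assumes "i \<in> {1..sum_list c}"
  shows "blk c i < a \<longleftrightarrow> i \<le> card {i \<in> {1..sum_list c}. blk c i < a}"
proof -
  let ?S = "{i \<in> {1..sum_list c}. blk c i < a}"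
  show ?thesis
  proof
    assume "blk c i < a"
    then have "{1..i} \<subseteq> ?S" using assms blk_mono[of _ i c] by fastforce
    then show "i \<le> card ?S" using card_mono[of ?S "{1..i}"] by simp
  next
    assume le: "i \<le> card ?S"
    show "blk c i < a"
    proof (rule ccontr)
      assume "\<not> blk c i < a"
      then have "?S \<subseteq> {1..<i}"
      proof (intro subsetI)
        fix j assume n: "\<not> blk c i < a" and j: "j \<in> ?S"
        have "\<not> i \<le> j" using blk_mono[of i j c] n j assms by auto
        then show "j \<in> {1..<i}" using j by auto
      qed
      then have "card ?S \<le> i - 1" using card_mono[of "{1..<i}" ?S] by simp
      then show False using le assms by auto
    qed
  qed
qed

text \<open>Reading the ranks with respect to \<open>color_key\<close> as positions reverses \<open>exc_coloring\<close>;
  the color constraints are exactly what is needed for the colors to be recovered.\<close>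

lemma rank_on_color_key:
  assumes "(v, E) \<in> colored_words c" and j: "j \<in> {1..sum_list c}"
  defines "\<rho> \<equiv> rank_on {1..sum_list c} (color_key (sum_list c) v E)"
  shows "blk c (\<rho> j) = v j" and "\<rho> j < j \<longleftrightarrow> j \<in> E"
proof -
  let ?X = "{1..sum_list c}" and ?key = "color_key (sum_list c) v E"
  have v: "v \<in> words_on ?X (length c) (blk_size c)" and ok: "color_ok c v E"
    using assms(1) by (auto simp: colored_words_def)
  define C where "C a = card {i \<in> ?X. blk c i < a}" for a
  \<comment> \<open>The word \<open>v\<close> has content \<open>blk_size c\<close>, so colors of
    values and blocks of positions are equally distributed.\<close>
  have Cv: "C a = card {w \<in> ?X. v w < a}" if "a \<le> length c" for a
  proof -
    have "card {i \<in> ?X. blk c i = b} = card {w \<in> ?X. v w = b}" if "b < a" for b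
      using v card_blk_eq[of b c] that \<open>a \<le> length c\<close> by (auto simp: words_on_def)
    then show ?thesis unfolding C_def by (subst (1 2) card_less_eq_sum) simp_all
  qed
  have seg: "blk c i < a \<longleftrightarrow> i \<le> C a" if "i \<in> ?X" for i a
    unfolding C_def by (rule blk_initial_segment[OF that])
  define a where "a = v j"
  have a: "a < length c" using words_on_less[OF v j] by (simp add: a_def)
  have key_le: "?key w \<le> ?key j \<longleftrightarrow> v w < a \<or> v w = a \<and> (w \<in> E \<and> j \<notin> E \<or> (w \<in> E \<longleftrightarrow> j \<in> E) \<and> w \<le> j)"
    if "w \<in> ?X" for w
    using color_key_less_iff[OF j that, of v E] unfolding a_def not_less[symmetric]
    by (auto simp: not_less)
  have rho: "\<rho> j = card {w \<in> ?X. ?key w \<le> ?key j}" by (simp add: \<rho>_def rank_on_def)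
  \<comment> \<open>All values of color below \<open>a\<close>, and \<open>j\<close> itself, are
    counted in the rank of \<open>j\<close>, and every value counted there has color at most
    \<open>a\<close>. This places \<open>\<rho> j\<close> in block \<open>a\<close>.\<close>
  have "C a < \<rho> j"
  proof -
    have "insert j {w \<in> ?X. v w < a} \<subseteq> {w \<in> ?X. ?key w \<le> ?key j}"
      using j by (auto simp: key_le simp del: atLeastAtMost_iff)
    then have "card (insert j {w \<in> ?X. v w < a}) \<le> \<rho> j"
      unfolding rho by (intro card_mono) auto
    then show ?thesis using Cv[of a] a by (simp add: a_def)
  qed
  moreover have "\<rho> j \<le> C (Suc a)"
  proof -
    have "\<rho> j \<le> card {w \<in> ?X. v w < Suc a}"
      unfolding rho by (intro card_mono) (auto simp: key_le simp del: atLeastAtMost_iff)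
    then show ?thesis using Cv[of "Suc a"] a by simp
  qed
  moreover have rX: "\<rho> j \<in> ?X"
    using bij_betw_rank_on[OF _ inj_on_color_key[of "sum_list c" v E]] j by (auto simp: bij_betw_def \<rho>_def)
  ultimately have blk_rho: "blk c (\<rho> j) = a"
    using seg[OF rX, of a] seg[OF rX, of "Suc a"] by simp
  then show "blk c (\<rho> j) = v j" by (simp add: a_def)
  have okw: "w \<in> E" if "w \<in> ?X" "v w < blk c w" for w using ok that by (auto simp: color_ok_def)
  have okw': "w \<notin> E" if "w \<in> ?X" "v w > blk c w" for w using ok that by (auto simp: color_ok_def)
  have okw'': "w \<notin> E" if "w \<in> ?X" "v w = blk c w" "blk_first c w" for w
    using ok that by (auto simp: color_ok_def)
  show "\<rho> j < j \<longleftrightarrow> j \<in> E"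
  proof (cases a "blk c j" rule: linorder_cases)
    case less
    then have "\<not> j \<le> \<rho> j" using blk_mono[of j "\<rho> j" c] j rX blk_rho by auto
    then show ?thesis using okw[OF j] less by (simp add: a_def)
  next
    case greater
    then have "\<not> \<rho> j \<le> j" using blk_mono[of "\<rho> j" j c] j rX blk_rho by auto
    then show ?thesis using okw'[OF j] greater by (simp add: a_def)
  next
    case equal
    show ?thesis
    proof (cases "j \<in> E")
      case True
      \<comment> \<open>Values of color \<open>a\<close> ranked up to \<open>j\<close>. Being in
        \<open>E\<close>, they are as positions in block \<open>a\<close> or later, and
        \<open>C a + 1\<close> is excluded as the first position of its block. So there are at most
        \<open>j - C a - 1\<close> of them; the excluded position makes \<open>\<rho> j < j\<close>
        strict.\<close>
      let ?S = "{w \<in> ?X. v w = a \<and> w \<in> E \<and> w \<le> j}"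
      have S: "?S \<subseteq> {C a + 2..j}"
      proof
        fix w assume w: "w \<in> ?S"
        then have wX: "w \<in> ?X" "v w = a" "w \<in> E" "w \<le> j" by auto
        have ge: "blk c w \<ge> a" using okw'[OF wX(1)] wX by (meson not_le)
        then have "w > C a" using seg[OF wX(1), of a] by simp
        moreover have "w \<noteq> Suc (C a)"
        proof
          assume eq: "w = Suc (C a)"
          have "blk c w \<le> blk c j" using wX j by (intro blk_mono) auto
          then have bw: "blk c w = a" using ge equal by simp
          have "blk c i < blk c w" if "1 \<le> i" "i < w" for i
            using seg[of i a] that wX(1) eq bw by auto
          then have "blk_first c w" using blk_first_iff[of w c] wX(1) by auto
          then show False using okw''[OF wX(1)] wX bw by simp
        qed
        ultimately show "w \<in> {C a + 2..j}" using wX by simp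
      qed
      have "j \<in> ?S" using j True by (simp add: a_def)
      then have Cj: "C a + 2 \<le> j" using S by auto
      have "{w \<in> ?X. ?key w \<le> ?key j} \<subseteq> {w \<in> ?X. v w < a} \<union> ?S"
        using True by (auto simp: key_le simp del: atLeastAtMost_iff)
      then have "\<rho> j \<le> card ({w \<in> ?X. v w < a} \<union> ?S)" unfolding rho by (intro card_mono) auto
      also have "\<dots> \<le> card {w \<in> ?X. v w < a} + card ?S" by (rule card_Un_le)
      also have "card {w \<in> ?X. v w < a} = C a" using Cv[of a] a by simp
      also have "card ?S \<le> card {C a + 2..j}" by (rule card_mono[OF _ S]) simp
      finally show ?thesis using Cj True by simp
    next
      case False
      \<comment> \<open>Values of color \<open>a\<close> ranked after \<open>j\<close>. Being
        outside \<open>E\<close>, they are as positions in block \<open>a\<close> or earlier, hence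
        in \<open>{j + 1..C (Suc a)}\<close>. So at least \<open>j\<close> of the
        \<open>C (Suc a)\<close> values of color at most \<open>a\<close> are ranked up to
        \<open>j\<close>.\<close>
      let ?S = "{w \<in> ?X. v w = a \<and> w \<notin> E \<and> w > j}"
      have S: "?S \<subseteq> {j + 1..C (Suc a)}"
      proof
        fix w assume w: "w \<in> ?S"
        then have wX: "w \<in> ?X" "v w = a" "w \<notin> E" "w > j" by auto
        have "blk c w < Suc a" using okw[OF wX(1)] wX by (meson less_Suc_eq_le not_le)
        then show "w \<in> {j + 1..C (Suc a)}" using seg[OF wX(1), of "Suc a"] wX(4) by simp
      qed
      have jC: "j \<le> C (Suc a)" using seg[OF j, of "Suc a"] equal by simp
      have "{w \<in> ?X. v w < Suc a} \<subseteq> {w \<in> ?X. ?key w \<le> ?key j} \<union> ?S"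
        using False by (auto simp: key_le less_Suc_eq simp del: atLeastAtMost_iff)
      then have "card {w \<in> ?X. v w < Suc a} \<le> card ({w \<in> ?X. ?key w \<le> ?key j} \<union> ?S)"
        by (intro card_mono) auto
      also have "\<dots> \<le> \<rho> j + card ?S" unfolding rho by (rule card_Un_le)
      also have "card ?S \<le> card {j + 1..C (Suc a)}" by (rule card_mono[OF _ S]) simp
      finally show ?thesis using Cv[of "Suc a"] a jC False by simp
    qed
  qed
qed

lemma bij_betw_exc_coloring:
  "bij_betw (exc_coloring c) {\<sigma>. \<sigma> permutes {1..sum_list c} \<and> bsorted c (bar_word (sum_list c) \<sigma>)}
    (colored_words c)" (is "bij_betw _ ?A _")
  unfolding bij_betw_def
proof (intro conjI)
  let ?X = "{1..sum_list c}"
  show "inj_on (exc_coloring c) ?A"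
  proof (rule inj_onI)
    fix \<sigma> \<tau> assume a: "\<sigma> \<in> ?A" "\<tau> \<in> ?A" "exc_coloring c \<sigma> = exc_coloring c \<tau>"
    obtain v E where vE: "exc_coloring c \<sigma> = (v, E)" by fastforce
    have "inv \<sigma> x = inv \<tau> x" for x
    proof (cases "x \<in> ?X")
      case True
      then show ?thesis using inv_eq_rank_on[of \<sigma> c v E x] inv_eq_rank_on[of \<tau> c v E x] a vE by simp
    next
      case False
      then show ?thesis
        using permutes_not_in[OF permutes_inv, of \<sigma> ?X x] permutes_not_in[OF permutes_inv, of \<tau> ?X x] a by simp
    qed
    then have "inv \<sigma> = inv \<tau>" by (rule ext)
    moreover have "inv (inv \<sigma>) = \<sigma>" "inv (inv \<tau>) = \<tau>"
      using a(1,2) by (auto intro: permutes_inv_inv)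
    ultimately show "\<sigma> = \<tau>" by metis
  qed
  show "exc_coloring c ` ?A = colored_words c"
  proof (intro set_eqI iffI)
    fix p assume "p \<in> exc_coloring c ` ?A"
    then show "p \<in> colored_words c" using exc_coloring_in by auto
  next
    fix p assume p: "p \<in> colored_words c"
    obtain v E where vE: "p = (v, E)" by fastforce
    let ?key = "color_key (sum_list c) v E"
    \<comment> \<open>The candidate for \<open>inv \<sigma>\<close>: it sends a value to its rank,
      by \<open>inv_eq_rank_on\<close> the only possible position.\<close>
    define \<tau> where "\<tau> x = (if x \<in> ?X then rank_on ?X ?key x else x)" for x
    have bij: "bij_betw (rank_on ?X ?key) ?X ?X"
      using bij_betw_rank_on[OF _ inj_on_color_key[of "sum_list c" v E]] by simp
    have \<tau>: "\<tau> permutes ?X"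
    proof (rule bij_imp_permutes)
      show "bij_betw \<tau> ?X ?X"
        by (rule bij_betw_cong[THEN iffD1, OF _ bij]) (simp add: \<tau>_def)
    qed (auto simp: \<tau>_def)
    define \<sigma> where "\<sigma> = inv \<tau>"
    have \<sigma>: "\<sigma> permutes ?X" unfolding \<sigma>_def by (rule permutes_inv[OF \<tau>])
    have inv: "inv \<sigma> = \<tau>" unfolding \<sigma>_def by (rule permutes_inv_inv[OF \<tau>])
    have st: "\<tau> (\<sigma> i) = i" for i unfolding \<sigma>_def by (rule permutes_inverses(1)[OF \<tau>])
    note rk = rank_on_color_key[OF p[unfolded vE]]
    have blk: "blk c (\<tau> j) = v j" and exc: "\<tau> j < j \<longleftrightarrow> j \<in> E" if "j \<in> ?X" for j
      using rk[OF that] that by (simp_all add: \<tau>_def)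
    have v: "v \<in> words_on ?X (length c) (blk_size c)" and ok: "color_ok c v E"
      using p vE by (auto simp: colored_words_def)
    have "exc_coloring c \<sigma> = p"
    proof -
      have "restrict (\<lambda>j. blk c (\<tau> j)) ?X = v"
      proof (rule ext)
        fix j show "restrict (\<lambda>j. blk c (\<tau> j)) ?X j = v j"
          using blk[of j] v by (cases "j \<in> ?X") (auto simp: words_on_def PiE_def extensional_def)
      qed
      moreover have "{j \<in> ?X. \<tau> j < j} = E"
        using exc ok unfolding color_ok_def by blast
      ultimately show ?thesis by (simp add: exc_coloring_def inv vE)
    qed
    moreover have "bsorted c (bar_word (sum_list c) \<sigma>)"
      unfolding bsorted_bar_word_iff
    proof (intro allI impI)
      fix i k assume ik: "1 \<le> i \<and> i < k \<and> k \<le> sum_list c \<and> blk c i = blk c k"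
      then have "i \<in> ?X" "k \<in> ?X" by auto
      then have X: "\<sigma> i \<in> ?X" "\<sigma> k \<in> ?X" using permutes_in_image[OF \<sigma>] by auto
      have "rank_on ?X ?key (\<sigma> i) < rank_on ?X ?key (\<sigma> k)"
        using st[of i] st[of k] X ik by (simp add: \<tau>_def)
      then have "?key (\<sigma> i) < ?key (\<sigma> k)" using rank_on_less_iff[of ?X "\<sigma> i" "\<sigma> k" ?key] X by simp
      moreover have "v (\<sigma> i) = v (\<sigma> k)" using blk[OF X(1)] blk[OF X(2)] st ik by simp
      ultimately have c: "\<sigma> i \<in> E \<and> \<sigma> k \<notin> E \<or> (\<sigma> i \<in> E \<longleftrightarrow> \<sigma> k \<in> E) \<and> \<sigma> i < \<sigma> k"
        using color_key_less_iff[OF X] by auto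
      have e: "\<sigma> i \<in> E \<longleftrightarrow> i < \<sigma> i" "\<sigma> k \<in> E \<longleftrightarrow> k < \<sigma> k" using exc[OF X(1)] exc[OF X(2)] st by auto
      show "\<sigma> i + (if i < \<sigma> i then 0 else sum_list c) \<le> \<sigma> k + (if k < \<sigma> k then 0 else sum_list c)"
        using c X unfolding e by auto
    qed
    ultimately show "p \<in> exc_coloring c ` ?A" using \<sigma> by blast
  qed
qed

text \<open>\<open>\<sigma>\<close> maps the excedances bijectively to the excedance letters; the
  position \<open>n\<close> is never an excedance.\<close>

lemma exc_eq_card_coloring:
  assumes \<sigma>: "\<sigma> permutes {1..n}" and n: "n = sum_list c"
  shows "exc n \<sigma> = card (snd (exc_coloring c \<sigma>))"
proof -
  have "bij_betw \<sigma> {i \<in> {1..n - 1}. \<sigma> i > i} {j \<in> {1..n}. inv \<sigma> j < j}"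
  proof (rule bij_betw_subset[OF permutes_imp_bij[OF \<sigma>]])
    show "\<sigma> ` {i \<in> {1..n - 1}. \<sigma> i > i} = {j \<in> {1..n}. inv \<sigma> j < j}"
    proof (intro set_eqI iffI)
      fix j assume "j \<in> \<sigma> ` {i \<in> {1..n - 1}. \<sigma> i > i}"
      then obtain i where i: "i \<in> {1..n - 1}" "\<sigma> i > i" "j = \<sigma> i" by blast
      then have "i \<in> {1..n}" by auto
      then have "\<sigma> i \<in> {1..n}" using permutes_in_image[OF \<sigma>] by blast
      then show "j \<in> {j \<in> {1..n}. inv \<sigma> j < j}" using i permutes_inverses(2)[OF \<sigma>] by simp
    next
      fix j assume "j \<in> {j \<in> {1..n}. inv \<sigma> j < j}"
      then have j: "j \<in> {1..n}" "inv \<sigma> j < j" by auto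
      then have "inv \<sigma> j \<in> {1..n - 1}" using inv_in_range[OF \<sigma> j(1)] by auto
      then show "j \<in> \<sigma> ` {i \<in> {1..n - 1}. \<sigma> i > i}"
        using j permutes_inverses(1)[OF \<sigma>] by (intro image_eqI[of _ _ "inv \<sigma> j"]) auto
    qed
  qed auto
  then show ?thesis unfolding exc_def exc_coloring_def n by (simp add: bij_betw_same_card)
qed

text \<open>The conditions of \<open>color_ok\<close> concern each \<open>j\<close> separately, so
  the sum factors: \<open>j\<close> contributes \<open>t\<close> if it may belong to
  \<open>E\<close>, plus 1 if it may stay outside.\<close>

lemma sum_color_ok:
  fixes t :: "'a::comm_ring_1"
  shows "(\<Sum>E | color_ok c v E. t ^ card E) = (\<Prod>j\<in>{1..sum_list c}. blk_weight t c j (v j))"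
proof -
  let ?X = "{1..sum_list c}"
  let ?in = "\<lambda>j. v j < blk c j \<or> v j = blk c j \<and> \<not> blk_first c j"
  let ?out = "\<lambda>j. v j \<ge> blk c j"
  let ?x = "\<lambda>j. if ?in j then t else 0" and ?y = "\<lambda>j. if ?out j then 1 else 0 :: 'a"
  have fin: "finite E" if "E \<subseteq> ?X" for E using that finite_subset by blast
  have "(\<Prod>j\<in>?X. blk_weight t c j (v j)) = (\<Prod>j\<in>?X. ?x j + ?y j)"
    by (rule prod.cong) (auto simp: blk_weight_def)
  also have "\<dots> = (\<Sum>E\<in>Pow ?X. prod ?x E * prod ?y (?X - E))"
    by (rule prod_add) simp
  also have "\<dots> = (\<Sum>E\<in>Pow ?X. if color_ok c v E then t ^ card E else 0)"
  proof (rule sum.cong[OF refl])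
    fix E assume E: "E \<in> Pow ?X"
    have ok: "color_ok c v E \<longleftrightarrow> (\<forall>j\<in>E. ?in j) \<and> (\<forall>j\<in>?X - E. ?out j)"
    proof
      assume "color_ok c v E"
      then show "(\<forall>j\<in>E. ?in j) \<and> (\<forall>j\<in>?X - E. ?out j)"
        unfolding color_ok_def by (metis DiffE linorder_neqE_nat not_le subsetD)
    next
      assume *: "(\<forall>j\<in>E. ?in j) \<and> (\<forall>j\<in>?X - E. ?out j)"
      show "color_ok c v E"
        unfolding color_ok_def
      proof (intro conjI ballI impI)
        fix j assume "j \<in> ?X" "v j < blk c j"
        then show "j \<in> E" using * by (metis DiffI not_le)
      next
        fix j assume "v j > blk c j"
        then show "j \<notin> E" using * by (metis less_asym less_irrefl)
      next
        fix j assume "v j = blk c j \<and> blk_first c j"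
        then show "j \<notin> E" using * by (metis less_irrefl)
      qed (use E in simp)
    qed
    show "prod ?x E * prod ?y (?X - E) = (if color_ok c v E then t ^ card E else 0)"
    proof (cases "color_ok c v E")
      case True
      then have "prod ?x E = (\<Prod>j\<in>E. t)" "prod ?y (?X - E) = (\<Prod>j\<in>?X - E. 1)"
        using ok by (auto intro!: prod.cong)
      then show ?thesis using True by simp
    next
      case False
      then consider j where "j \<in> E" "\<not> ?in j" | j where "j \<in> ?X - E" "\<not> ?out j" using ok by blast
      then have "prod ?x E * prod ?y (?X - E) = 0"
      proof cases
        case 1
        then have "prod ?x E = 0" using fin[of E] E by (intro prod_zero) auto
        then show ?thesis by simp
      next
        case 2
        then have "prod ?y (?X - E) = 0" by (intro prod_zero) auto
        then show ?thesis by simp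
      qed
      then show ?thesis using False by simp
    qed
  qed
  also have "\<dots> = (\<Sum>E | E \<in> Pow ?X \<and> color_ok c v E. t ^ card E)"
    by (rule sum.inter_filter[symmetric]) simp
  also have "{E. E \<in> Pow ?X \<and> color_ok c v E} = {E. color_ok c v E}"
    by (auto simp: color_ok_def)
  finally show ?thesis by simp
qed

text \<open>By the bijection with colored words this is a sum over pairs of a word \<open>v\<close>
  and a set \<open>E\<close>. Summing over \<open>E\<close> first produces the weights of
  \<open>blk_poly\<close> at \<open>s = 0\<close>.\<close>

theorem sum_exc_bsorted:
  fixes t :: "'a::comm_ring_1"
  assumes n: "n = sum_list c"
  shows "(\<Sum>\<sigma> | \<sigma> permutes {1..n} \<and> bsorted c (bar_word n \<sigma>). t ^ exc n \<sigma>) = poly (blk_poly t c) 0"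
proof -
  let ?A = "{\<sigma>. \<sigma> permutes {1..n} \<and> bsorted c (bar_word n \<sigma>)}"
  let ?W = "words_on {1..n} (length c) (blk_size c)"
  have "(\<Sum>\<sigma>\<in>?A. t ^ exc n \<sigma>) = (\<Sum>\<sigma>\<in>?A. t ^ card (snd (exc_coloring c \<sigma>)))"
    by (rule sum.cong) (auto simp: exc_eq_card_coloring[OF _ n])
  also have "\<dots> = (\<Sum>p\<in>colored_words c. t ^ card (snd p))"
    using sum.reindex_bij_betw[OF bij_betw_exc_coloring[of c], of "\<lambda>p. t ^ card (snd p)"] n by simp
  also have "\<dots> = (\<Sum>v\<in>?W. \<Sum>E | color_ok c v E. t ^ card E)"
  proof -
    have "finite {E. color_ok c v E}" for v
      by (rule finite_subset[of _ "Pow {1..n}"]) (auto simp: color_ok_def n)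
    then show ?thesis
      unfolding colored_words_def n[symmetric]
      by (subst sum.Sigma) (auto simp: finite_words_on case_prod_unfold)
  qed
  also have "\<dots> = word_sum {1..n} (length c) (blk_weight t c) (blk_size c)"
    unfolding sum_color_ok word_sum_def n ..
  also have "\<dots> = word_sum {1..n} (length c) (\<lambda>j a. poly [:blk_weight t c j a, 1:] 0) (blk_size c)" by simp
  also have "\<dots> = poly (blk_poly t c) 0"
    unfolding blk_poly_def n by (rule word_sum_hom[symmetric]) simp_all
  finally show ?thesis .
qed

section \<open>The recursion for codes\<close>

lemma subvecs_Cons_iff: "j # e \<in> subvecs (k # c) \<longleftrightarrow> j \<le> k \<and> e \<in> subvecs c"
  by (simp add: subvecs_def)

lemma sum_list_vec_diff: "e \<in> subvecs c \<Longrightarrow> sum_list (vec_diff c e) + sum_list e = sum_list c"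
proof (induction c arbitrary: e)
  case (Cons k c e')
  obtain j e where e': "e' = j # e" "j \<le> k" "e \<in> subvecs c"
    using Cons.prems by (auto simp: subvecs_Cons)
  then show ?case using Cons.IH[OF e'(3)] by simp
qed simp

lemma subvecs_sum_list_0:
  "{e \<in> subvecs c. sum_list e = 0} = {replicate (length c) 0}"
proof (induction c)
  case (Cons k c)
  have "{e \<in> subvecs (k # c). sum_list e = 0} = (#) 0 ` {e \<in> subvecs c. sum_list e = 0}"
    by (auto simp: subvecs_Cons)
  also have "\<dots> = {replicate (length (k # c)) 0}" unfolding Cons.IH by simp
  finally show ?case .
qed auto

lemma vec_diff_replicate_0: "vec_diff c (replicate (length c) 0) = c"
  by (induction c) simp_all

text \<open>The vector prescribes how many copies of \<open>m\<close> are appended to each block of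
  \<open>w\<close>, whose block sizes are given by \<open>vec_diff\<close>. The last equation gives
  the value for no blocks and is the default for lists of different lengths.\<close>

fun insert_letter :: "nat list \<Rightarrow> nat list \<Rightarrow> nat \<Rightarrow> nat list \<Rightarrow> nat list" where
  "insert_letter (k # c) (j # e) m w =
     insert_letter c e m (take (sum_list (vec_diff c e)) w) @ drop (sum_list (vec_diff c e)) w @ replicate j m"
| "insert_letter _ _ m w = []"

fun letter_counts :: "nat list \<Rightarrow> nat \<Rightarrow> nat list \<Rightarrow> nat list" where
  "letter_counts [] m w = []"
| "letter_counts (k # c) m w = count_list (drop (sum_list c) w) m # letter_counts c m (take (sum_list c) w)"

lemma sum_list_letter_counts:
  "length w = sum_list c \<Longrightarrow> sum_list (letter_counts c m w) = count_list w m"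
proof (induction c arbitrary: w)
  case (Cons k c)
  have "count_list w m = count_list (take (sum_list c) w) m + count_list (drop (sum_list c) w) m"
    by (simp flip: count_list_append)
  then show ?case using Cons.IH[of "take (sum_list c) w"] Cons.prems by simp
qed simp

lemma letter_counts_in_subvecs:
  "length w = sum_list c \<Longrightarrow> letter_counts c m w \<in> subvecs c"
proof (induction c arbitrary: w)
  case (Cons k c)
  have "count_list (drop (sum_list c) w) m \<le> k"
    using count_le_length[of "drop (sum_list c) w" m] Cons.prems by simp
  then show ?case using Cons.IH[of "take (sum_list c) w"] Cons.prems by (simp add: subvecs_Cons_iff)
qed simp

lemma sorted_filter_neq_append:
  fixes xs :: "nat list"
  assumes "sorted xs" "\<forall>x\<in>set xs. x \<le> m"
  shows "filter (\<lambda>x. x \<noteq> m) xs @ replicate (count_list xs m) m = xs"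
  using assms
proof (induction xs)
  case (Cons x xs)
  show ?case
  proof (cases "x = m")
    case True
    then have eq: "\<forall>y\<in>set xs. y = m" using Cons.prems by (auto intro: le_antisym)
    then have "filter (\<lambda>x. x \<noteq> m) xs = []" by (simp add: filter_empty_conv)
    then show ?thesis using Cons True by simp
  next
    case False
    then show ?thesis using Cons by simp
  qed
qed simp

text \<open>In an increasing block the copies of the largest letter stand at the end, so their
  number in each block suffices to restore the word.\<close>

lemma remove_letter:
  assumes "bsorted c w" "\<forall>x\<in>set w. x \<le> m"
  shows "bsorted (vec_diff c (letter_counts c m w)) (filter (\<lambda>x. x \<noteq> m) w)"
    and "insert_letter c (letter_counts c m w) m (filter (\<lambda>x. x \<noteq> m) w) = w"
  using assms
proof (induction c arbitrary: w)
  case Nil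
  case 1 then show ?case by simp
  case 2 then show ?case by simp
next
  case (Cons k c)
  let ?F = "filter (\<lambda>x. x \<noteq> m)"
  \<comment> \<open>The two conclusions are linked: sortedness of the shortened prefix gives its
    length, which tells \<open>insert_letter\<close> where to cut.\<close>
  have *: "bsorted (vec_diff (k # c) (letter_counts (k # c) m w)) (?F w)
      \<and> insert_letter (k # c) (letter_counts (k # c) m w) m (?F w) = w"
    if w: "bsorted (k # c) w" "\<forall>x\<in>set w. x \<le> m" for w
  proof -
    let ?u = "take (sum_list c) w" and ?v = "drop (sum_list c) w"
    have u: "bsorted c ?u" "\<forall>x\<in>set ?u. x \<le> m" using w by (auto dest: in_set_takeD)
    have v: "sorted ?v" "\<forall>x\<in>set ?v. x \<le> m" using w by (auto dest: in_set_dropD)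
    note IH = Cons.IH(1)[OF u] Cons.IH(2)[OF u]
    have F: "?F w = ?F ?u @ ?F ?v" by (simp flip: filter_append)
    have lu: "length (?F ?u) = sum_list (vec_diff c (letter_counts c m ?u))"
      by (rule bsorted_length[OF IH(1)])
    have lv: "length (?F ?v) + count_list ?v m = k"
      using arg_cong[OF sorted_filter_neq_append[OF v], of length] w by simp
    have sv: "sorted (?F ?v)" using v(1) by (rule sorted_filter[where f = id, simplified])
    have "insert_letter (k # c) (letter_counts (k # c) m w) m (?F w) = ?u @ ?F ?v @ replicate (count_list ?v m) m"
      unfolding F by (simp add: lu[symmetric] IH(2))
    also have "\<dots> = w" by (simp add: sorted_filter_neq_append[OF v])
    finally show ?thesis
      unfolding F using IH(1) sv lv by (simp add: lu[symmetric])
  qed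
  case 1
  from *[OF 1] show ?case by blast
  case 2
  from *[OF 2] show ?case by blast
qed

text \<open>Appending a letter larger than all others keeps every block increasing, and its copies
  can be recognized afterwards. So this inverts the removal.\<close>

lemma insert_letter:
  assumes "e \<in> subvecs c" "bsorted (vec_diff c e) w" "\<forall>x\<in>set w. x < m"
  shows "bsorted c (insert_letter c e m w) \<and> letter_counts c m (insert_letter c e m w) = e \<and>
    filter (\<lambda>x. x \<noteq> m) (insert_letter c e m w) = w \<and>
    mset (insert_letter c e m w) = mset w + replicate_mset (sum_list e) m"
  using assms
proof (induction c arbitrary: e w)
  case (Cons k c e' w)
  obtain j e where e': "e' = j # e" and j: "j \<le> k" and e: "e \<in> subvecs c"
    using Cons.prems(1) by (auto simp: subvecs_Cons)
  let ?n = "sum_list (vec_diff c e)"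
  let ?u = "take ?n w" and ?v = "drop ?n w"
  let ?x = "insert_letter c e m ?u"
  have w: "length w = ?n + (k - j)" "bsorted (vec_diff c e) ?u" "sorted ?v"
    using Cons.prems(2) by (simp_all add: e')
  have lt: "\<forall>x\<in>set ?u. x < m" "\<forall>x\<in>set ?v. x < m"
    using Cons.prems(3) by (auto dest: in_set_takeD in_set_dropD)
  note IH = Cons.IH[OF e w(2) lt(1)]
  have lx: "length ?x = sum_list c" using IH bsorted_length by blast
  have "sorted (?v @ replicate j m)" using w(3) lt(2) by (auto simp: sorted_append intro: less_imp_le)
  then have 1: "bsorted (k # c) (insert_letter (k # c) (j # e) m w)"
    using IH lx w(1) j by simp
  have "count_list (replicate j m) m = j" by (induction j) simp_all
  moreover have "count_list ?v m = 0" using lt(2) by (auto simp: count_list_0_iff)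
  ultimately have 2: "letter_counts (k # c) m (insert_letter (k # c) (j # e) m w) = j # e"
    using IH lx by (simp add: count_list_append)
  have "filter (\<lambda>x. x \<noteq> m) ?v = ?v" using lt(2) by (auto simp: filter_id_conv)
  then have 3: "filter (\<lambda>x. x \<noteq> m) (insert_letter (k # c) (j # e) m w) = w"
    using IH by simp
  have "mset ?u + mset ?v = mset w" by (simp flip: mset_append)
  have 4: "mset (insert_letter (k # c) (j # e) m w) = mset w + replicate_mset (sum_list (j # e)) m"
  proof -
    have "replicate_mset (a + b) m = replicate_mset a m + replicate_mset b m" for a b
      by (induction a) simp_all
    then show ?thesis using IH \<open>mset ?u + mset ?v = mset w\<close>[symmetric] by (simp add: add_ac)
  qed
  show ?case unfolding e' using 1 2 3 4 by blast
qed simp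

lemma max_letter_eqI:
  assumes "\<forall>x\<in>set \<alpha>. x \<le> m" "m = 0 \<or> m \<in> set \<alpha>"
  shows "max_letter \<alpha> = m"
  unfolding max_letter_def by (rule Max_eqI) (use assms in auto)

lemma max_letter_ge: "x \<in> set \<alpha> \<Longrightarrow> x \<le> max_letter \<alpha>"
  unfolding max_letter_def by (rule Max_ge) auto

section \<open>Codes with increasing blocks\<close>

definition sorted_codes :: "nat list \<Rightarrow> (nat list \<times> (nat \<Rightarrow> nat)) set" where
  "sorted_codes c = {(\<alpha>, f) \<in> Code (sum_list c). bsorted c \<alpha>}"

lemma finite_sorted_codes: "finite (sorted_codes c)"
  by (rule finite_subset[OF _ finite_Code[of "sum_list c"]]) (auto simp: sorted_codes_def)

definition code_sum :: "'a::comm_ring_1 \<Rightarrow> nat list \<Rightarrow> 'a" where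
  "code_sum t c = (\<Sum>(\<alpha>, f)\<in>sorted_codes c. t ^ ind \<alpha> f)"

lemma bsorted_replicate: "bsorted c (replicate (sum_list c) x)"
  by (induction c) (simp_all add: min_def)

lemma sorted_codes_max_letter_0:
  "{(\<alpha>, f) \<in> sorted_codes c. max_letter \<alpha> = 0} = {(replicate (sum_list c) 0, \<lambda>_. undefined)}"
proof (intro set_eqI iffI)
  fix p assume "p \<in> {(\<alpha>, f) \<in> sorted_codes c. max_letter \<alpha> = 0}"
  then obtain \<alpha> f where p: "p = (\<alpha>, f)" and c: "(\<alpha>, f) \<in> Code (sum_list c)" and m: "max_letter \<alpha> = 0"
    by (auto simp: sorted_codes_def)
  have "\<forall>x\<in>set \<alpha>. x = 0" using max_letter_ge[of _ \<alpha>] m by auto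
  then have "\<alpha> = replicate (length \<alpha>) 0" by (metis replicate_length_same)
  moreover have "f = (\<lambda>_. undefined)" using c m by (simp add: Code_def)
  ultimately show "p \<in> {(replicate (sum_list c) 0, \<lambda>_. undefined)}" using c p by (simp add: Code_def)
next
  fix p assume "p \<in> {(replicate (sum_list c) (0::nat), \<lambda>_::nat. undefined :: nat)}"
  moreover have "max_letter (replicate (sum_list c) 0) = 0"
    by (rule max_letter_eqI) auto
  ultimately show "p \<in> {(\<alpha>, f) \<in> sorted_codes c. max_letter \<alpha> = 0}"
    by (simp add: sorted_codes_def Code_def bsorted_replicate)
qed

text \<open>The bijection removes all copies of the largest letter \<open>m\<close>. What remains is
  a code with maximum \<open>m - 1\<close>; \<open>e\<close> records the copies in each block, at
  least two in all, and the mark of \<open>m\<close> can be any of \<open>sum_list e - 1\<close>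
  values.\<close>

lemma sum_sorted_codes_max_letter_pos:
  fixes t :: "'a::comm_ring_1"
  shows "(\<Sum>(\<alpha>, f) | (\<alpha>, f) \<in> sorted_codes c \<and> max_letter \<alpha> > 0. t ^ ind \<alpha> f) =
    (\<Sum>e | e \<in> subvecs c \<and> sum_list e \<ge> 2. (\<Sum>i=1..sum_list e - 1. t ^ i) * code_sum t (vec_diff c e))"
proof -
  let ?E = "{e. e \<in> subvecs c \<and> sum_list e \<ge> 2}"
  let ?T = "SIGMA e:?E. {1..sum_list e - 1} \<times> sorted_codes (vec_diff c e)"
  let ?fw = "\<lambda>(\<alpha>, f). let m = max_letter \<alpha> in
    (letter_counts c m \<alpha>, f m, filter (\<lambda>x. x \<noteq> m) \<alpha>, restrict f {1..m - 1})"
  let ?bw = "\<lambda>(e, i, \<alpha>, f). let m = Suc (max_letter \<alpha>) in (insert_letter c e m \<alpha>, f(m := i))"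
  have "(\<Sum>(\<alpha>, f) | (\<alpha>, f) \<in> sorted_codes c \<and> max_letter \<alpha> > 0. t ^ ind \<alpha> f) =
      (\<Sum>(e, i, \<alpha>, f)\<in>?T. t ^ i * t ^ ind \<alpha> f)"
  proof (rule sum.reindex_bij_witness[where i = ?bw and j = ?fw])
    fix p assume "p \<in> {(\<alpha>, f). (\<alpha>, f) \<in> sorted_codes c \<and> max_letter \<alpha> > 0}"
    then obtain \<alpha> f where p: "p = (\<alpha>, f)" and code: "(\<alpha>, f) \<in> Code (sum_list c)"
      and bs: "bsorted c \<alpha>" and pos: "max_letter \<alpha> > 0"
      by (auto simp: sorted_codes_def)
    define m where "m = max_letter \<alpha>"
    define \<alpha>' where "\<alpha>' = filter (\<lambda>x. x \<noteq> m) \<alpha>"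
    define e where "e = letter_counts c m \<alpha>"
    have two: "count_list \<alpha> k \<ge> 2" if "k \<in> {1..m}" for k using code that by (simp add: Code_def m_def)
    have f: "f \<in> (\<Pi>\<^sub>E k\<in>{1..m}. {1..count_list \<alpha> k - 1})" using code by (simp add: Code_def m_def)
    have le: "\<forall>x\<in>set \<alpha>. x \<le> m" using max_letter_ge by (auto simp: m_def)
    have len: "length \<alpha> = sum_list c" using bs by (rule bsorted_length)
    have m1: "m \<in> {1..m}" using pos by (simp add: m_def)
    have sum_e: "sum_list e = count_list \<alpha> m" unfolding e_def by (rule sum_list_letter_counts[OF len])
    have e: "e \<in> ?E" using letter_counts_in_subvecs[OF len, of m] sum_e two[OF m1] by (simp add: e_def)
    have fm: "f m \<in> {1..sum_list e - 1}" using f m1 unfolding sum_e by (auto simp: PiE_def Pi_def)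
    have cnt: "count_list \<alpha>' k = count_list \<alpha> k" if "k \<noteq> m" for k
      unfolding \<alpha>'_def using that by (induction \<alpha>) auto
    \<comment> \<open>As every letter in \<open>{1..m}\<close> occurs, the maximum drops by exactly
      1, and the inverse map recovers \<open>m\<close> as its successor.\<close>
    have max': "max_letter \<alpha>' = m - 1"
    proof (rule max_letter_eqI)
      show "\<forall>x\<in>set \<alpha>'. x \<le> m - 1" using le by (force simp: \<alpha>'_def)
      show "m - 1 = 0 \<or> m - 1 \<in> set \<alpha>'"
      proof (cases "m - 1 = 0")
        case False
        then have "count_list \<alpha> (m - 1) \<ge> 2" by (intro two) auto
        then have "m - 1 \<in> set \<alpha>" by (metis count_list_0_iff not_numeral_le_zero)
        then show ?thesis using False by (simp add: \<alpha>'_def)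
      qed simp
    qed
    note rem = remove_letter[OF bs le, folded e_def \<alpha>'_def]
    have code': "(\<alpha>', restrict f {1..m - 1}) \<in> sorted_codes (vec_diff c e)"
    proof -
      have "count_list \<alpha>' k = count_list \<alpha> k" if "k \<in> {1..m - 1}" for k using that by (intro cnt) auto
      moreover have "f k \<in> {1..count_list \<alpha> k - 1}" if "k \<in> {1..m - 1}" for k
        using f that by (intro PiE_mem[OF f]) auto
      moreover have "count_list \<alpha> k \<ge> 2" if "k \<in> {1..m - 1}" for k using that by (intro two) auto
      ultimately show ?thesis
        using rem(1) bsorted_length[OF rem(1)] by (auto simp: sorted_codes_def Code_def max')
    qed
    have fw: "?fw p = (e, f m, \<alpha>', restrict f {1..m - 1})"
      by (simp add: p e_def \<alpha>'_def m_def Let_def)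
    show "?fw p \<in> ?T" unfolding fw using e fm code' by simp
    have "(restrict f {1..m - 1})(m := f m) = f"
    proof (rule ext)
      fix k
      show "((restrict f {1..m - 1})(m := f m)) k = f k"
        using f m1 by (cases "k \<in> {1..m}") (auto simp: PiE_def extensional_def)
    qed
    then show "?bw (?fw p) = p"
      unfolding fw using rem(2) m1 by (simp add: max' p)
    have "{1..m} = insert m {1..m - 1}" using m1 by auto
    moreover have "m \<notin> {1..m - 1}" using m1 by auto
    ultimately have "ind \<alpha> f = f m + (\<Sum>k=1..m - 1. f k)" by (simp add: ind_def flip: m_def)
    also have "(\<Sum>k=1..m - 1. f k) = ind \<alpha>' (restrict f {1..m - 1})" by (simp add: ind_def max')
    finally show "(case ?fw p of (e, i, \<alpha>, f) \<Rightarrow> t ^ i * t ^ ind \<alpha> f) = (case p of (\<alpha>, f) \<Rightarrow> t ^ ind \<alpha> f)"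
      unfolding fw by (simp add: p power_add)
  next
    fix p assume "p \<in> ?T"
    then obtain e i \<alpha>' f' where p: "p = (e, i, \<alpha>', f')" and e: "e \<in> subvecs c" "sum_list e \<ge> 2"
      and i: "i \<in> {1..sum_list e - 1}" and code: "(\<alpha>', f') \<in> Code (sum_list (vec_diff c e))"
      and bs: "bsorted (vec_diff c e) \<alpha>'"
      by (auto simp: sorted_codes_def)
    define m where "m = Suc (max_letter \<alpha>')"
    define \<alpha> where "\<alpha> = insert_letter c e m \<alpha>'"
    have lt: "\<forall>x\<in>set \<alpha>'. x < m" using max_letter_ge[of _ \<alpha>'] by (auto simp: m_def less_Suc_eq_le)
    note ins = insert_letter[OF e(1) bs lt, folded \<alpha>_def]
    have cnt: "count_list \<alpha> k = count_list \<alpha>' k + (if k = m then sum_list e else 0)" for k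
    proof -
      have "count (mset \<alpha>) k = count (mset \<alpha>') k + (if k = m then sum_list e else 0)"
        using ins by (auto simp: count_replicate_mset)
      then show ?thesis by (simp add: count_mset)
    qed
    have cnt'm: "count_list \<alpha>' m = 0" using lt by (auto simp: count_list_0_iff)
    have set: "set \<alpha> = insert m (set \<alpha>')"
    proof -
      have "set_mset (mset \<alpha>) = set_mset (mset \<alpha>' + replicate_mset (sum_list e) m)" using ins by simp
      moreover have "sum_list e \<noteq> 0" using e(2) by linarith
      ultimately show ?thesis by (simp del: sum_list_eq_0_iff)
    qed
    have max: "max_letter \<alpha> = m"
      by (rule max_letter_eqI) (use set lt in \<open>auto intro: less_imp_le\<close>)
    have f': "f' \<in> (\<Pi>\<^sub>E k\<in>{1..m - 1}. {1..count_list \<alpha>' k - 1})"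
      and two: "\<forall>k\<in>{1..m - 1}. count_list \<alpha>' k \<ge> 2"
      using code by (simp_all add: Code_def m_def)
    have f: "f'(m := i) \<in> (\<Pi>\<^sub>E k\<in>{1..m}. {1..count_list \<alpha> k - 1})"
    proof (rule PiE_I)
      fix k assume k: "k \<in> {1..m}"
      show "(f'(m := i)) k \<in> {1..count_list \<alpha> k - 1}"
      proof (cases "k = m")
        case True
        then show ?thesis using i by (simp add: cnt cnt'm)
      next
        case False
        then have "k \<in> {1..m - 1}" using k by auto
        then show ?thesis using PiE_mem[OF f'] False by (simp add: cnt)
      qed
    next
      fix k assume "k \<notin> {1..m}"
      then have "k \<notin> {1..m - 1}" "k \<noteq> m" by (auto simp: m_def)
      then show "(f'(m := i)) k = undefined" using PiE_arb[OF f'] by simp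
    qed
    have "count_list \<alpha> k \<ge> 2" if k: "k \<in> {1..m}" for k
    proof (cases "k = m")
      case True
      then show ?thesis using e(2) by (simp add: cnt)
    next
      case False
      then have "k \<in> {1..m - 1}" using k by auto
      then show ?thesis using two False by (simp add: cnt)
    qed
    then have code': "(\<alpha>, f'(m := i)) \<in> sorted_codes c"
      using ins f bsorted_length[of c \<alpha>] by (simp add: sorted_codes_def Code_def max)
    have bw: "?bw p = (\<alpha>, f'(m := i))"
      by (simp add: p m_def \<alpha>_def Let_def)
    show "?bw p \<in> {(\<alpha>, f). (\<alpha>, f) \<in> sorted_codes c \<and> max_letter \<alpha> > 0}"
      unfolding bw using code' by (simp add: max m_def)
    have "restrict (f'(m := i)) {1..m - 1} = f'"
    proof (rule ext)
      fix k show "restrict (f'(m := i)) {1..m - 1} k = f' k"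
        using PiE_arb[OF f', of k] by (cases "k \<in> {1..m - 1}") (auto simp: m_def)
    qed
    then show "?fw (?bw p) = p"
      unfolding bw using ins by (simp add: max p Let_def)
  qed
  also have "\<dots> = (\<Sum>e\<in>?E. \<Sum>(i, \<alpha>, f)\<in>{1..sum_list e - 1} \<times> sorted_codes (vec_diff c e). t ^ i * t ^ ind \<alpha> f)"
    by (rule sum.Sigma[symmetric]) (auto simp: finite_sorted_codes)
  also have "\<dots> = (\<Sum>e\<in>?E. (\<Sum>i=1..sum_list e - 1. t ^ i) * code_sum t (vec_diff c e))"
  proof (rule sum.cong[OF refl])
    fix e
    show "(\<Sum>(i, \<alpha>, f)\<in>{1..sum_list e - 1} \<times> sorted_codes (vec_diff c e). t ^ i * t ^ ind \<alpha> f) =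
        (\<Sum>i=1..sum_list e - 1. t ^ i) * code_sum t (vec_diff c e)"
      unfolding code_sum_def sum_product
      by (subst sum.cartesian_product) (simp add: case_prod_unfold)
  qed
  finally show ?thesis .
qed

text \<open>The summand 1 comes from the word of zeros, which carries the only code with maximum 0;
  its index is an empty sum.\<close>

lemma code_sum_rec:
  "code_sum t c = 1 + (\<Sum>e | e \<in> subvecs c \<and> sum_list e \<ge> 2.
    (\<Sum>i=1..sum_list e - 1. t ^ i) * code_sum t (vec_diff c e))"
proof -
  let ?A = "{(\<alpha>, f) \<in> sorted_codes c. max_letter \<alpha> = 0}"
  let ?B = "{(\<alpha>, f). (\<alpha>, f) \<in> sorted_codes c \<and> max_letter \<alpha> > 0}"
  have AB: "sorted_codes c = ?A \<union> ?B" by auto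
  have "finite ?A" "finite ?B" by (rule finite_subset[OF _ finite_sorted_codes[of c]], auto)+
  then have "code_sum t c = (\<Sum>(\<alpha>, f)\<in>?A. t ^ ind \<alpha> f) + (\<Sum>(\<alpha>, f)\<in>?B. t ^ ind \<alpha> f)"
    unfolding code_sum_def by (subst AB, intro sum.union_disjoint) auto
  also have "(\<Sum>(\<alpha>, f)\<in>?A. t ^ ind \<alpha> f) = 1"
  proof -
    have "max_letter (replicate (sum_list c) 0) = 0" by (rule max_letter_eqI) auto
    then show ?thesis unfolding sorted_codes_max_letter_0 by (simp add: ind_def)
  qed
  finally show ?thesis unfolding sum_sorted_codes_max_letter_pos .
qed

text \<open>The recursion times \<open>1 - t\<close>: the geometric sum becomes
  \<open>t - t ^ sum_list e\<close>, vectors of sum 1 drop out, and the zero vector gives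
  \<open>code_sum t c * (1 - t)\<close>. This is the form of \<open>blk_poly_identity\<close> at
  \<open>s = 0\<close>.\<close>

lemma code_sum_identity:
  fixes t :: "'a::comm_ring_1"
  shows "(\<Sum>e\<in>subvecs c. code_sum t (vec_diff c e) * (t ^ sum_list e - t)) = 1 - t"
proof -
  let ?g = "\<lambda>e. code_sum t (vec_diff c e) * (t ^ sum_list e - t)"
  let ?E0 = "{e \<in> subvecs c. sum_list e = 0}" and ?E2 = "{e. e \<in> subvecs c \<and> sum_list e \<ge> 2}"
  have "sum ?g (subvecs c) = sum ?g (?E0 \<union> ?E2)"
  proof (rule sum.mono_neutral_right)
    show "\<forall>e\<in>subvecs c - (?E0 \<union> ?E2). ?g e = 0"
    proof
      fix e assume "e \<in> subvecs c - (?E0 \<union> ?E2)"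
      then have "sum_list e \<noteq> 0 \<and> \<not> sum_list e \<ge> 2"
        by (metis (mono_tags, lifting) DiffD1 DiffD2 UnCI mem_Collect_eq)
      then have "sum_list e = 1" by linarith
      then show "?g e = 0" by simp
    qed
  qed auto
  also have "\<dots> = sum ?g ?E0 + sum ?g ?E2"
    by (rule sum.union_disjoint) (auto simp del: sum_list_eq_0_iff)
  also have "sum ?g ?E0 = code_sum t c * (1 - t)"
    unfolding subvecs_sum_list_0 by (simp add: vec_diff_replicate_0 sum_list_replicate)
  also have "sum ?g ?E2 = - (1 - t) * (\<Sum>e\<in>?E2. (\<Sum>i=1..sum_list e - 1. t ^ i) * code_sum t (vec_diff c e))"
    unfolding sum_distrib_left
  proof (rule sum.cong[OF refl])
    fix e assume "e \<in> ?E2"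
    then have "sum_list e \<ge> 1" by simp
    have "t ^ n - t = - (1 - t) * (\<Sum>i=1..n - 1. t ^ i)" if "n \<ge> 1" for n
      using that
    proof (induction n rule: nat_induct_at_least)
      case (Suc n)
      have "{1..Suc n - 1} = insert n {1..n - 1}" using Suc.hyps by auto
      then have "(\<Sum>i=1..Suc n - 1. t ^ i) = t ^ n + (\<Sum>i=1..n - 1. t ^ i)" using Suc.hyps by simp
      then have "- (1 - t) * (\<Sum>i=1..Suc n - 1. t ^ i) = - (1 - t) * t ^ n + (t ^ n - t)"
        by (simp only: Suc.IH distrib_left)
      then show ?case by (simp add: algebra_simps)
    qed simp
    from this[OF \<open>sum_list e \<ge> 1\<close>]
    show "?g e = - (1 - t) * ((\<Sum>i=1..sum_list e - 1. t ^ i) * code_sum t (vec_diff c e))"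
      by (simp only: mult_ac)
  qed
  finally show ?thesis
    using code_sum_rec[of t c] by (simp add: algebra_simps)
qed

text \<open>The zero vector contributes \<open>R c * (1 - t)\<close> with \<open>1 - t\<close>
  nonzero, and all other terms involve vectors of smaller sum. So the identity determines
  \<open>R\<close> recursively.\<close>

lemma convolution_identity_unique:
  fixes t :: "'a::idom"
  assumes "t \<noteq> 1"
    and R: "\<And>c. (\<Sum>e\<in>subvecs c. R (vec_diff c e) * (t ^ sum_list e - t)) = 1 - t"
    and R': "\<And>c. (\<Sum>e\<in>subvecs c. R' (vec_diff c e) * (t ^ sum_list e - t)) = 1 - t"
  shows "R c = R' c"
proof (induction "sum_list c" arbitrary: c rule: less_induct)
  case less
  let ?z = "replicate (length c) (0 :: nat)"
  have z: "?z \<in> subvecs c" using subvecs_sum_list_0[of c] by blast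
  have split: "R (c :: nat list) * (1 - t) = (1 - t) - (\<Sum>e\<in>subvecs c - {?z}. R (vec_diff c e) * (t ^ sum_list e - t))"
    if "\<And>c. (\<Sum>e\<in>subvecs c. R (vec_diff c e) * (t ^ sum_list e - t)) = 1 - t" for R
  proof -
    have "sum_list ?z = 0" by (simp add: sum_list_replicate)
    then have "1 - t = R c * (1 - t) + (\<Sum>e\<in>subvecs c - {?z}. R (vec_diff c e) * (t ^ sum_list e - t))"
      using that[of c] sum.remove[OF finite_subvecs z, of "\<lambda>e. R (vec_diff c e) * (t ^ sum_list e - t)"]
      by (simp only: vec_diff_replicate_0 power_0)
    from this[symmetric] show ?thesis by (simp only: eq_diff_eq)
  qed
  have "R (vec_diff c e) = R' (vec_diff c e)" if e: "e \<in> subvecs c - {?z}" for e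
  proof (rule less.hyps)
    have "sum_list e \<noteq> 0"
    proof
      assume "sum_list e = 0"
      then have "e \<in> {e \<in> subvecs c. sum_list e = 0}" using e by blast
      then show False unfolding subvecs_sum_list_0 using e by simp
    qed
    moreover have "e \<in> subvecs c" using e by simp
    ultimately show "sum_list (vec_diff c e) < sum_list c" using sum_list_vec_diff[of e c] by linarith
  qed
  then have "R c * (1 - t) = R' c * (1 - t)" unfolding split[of R, OF R] split[of R', OF R'] by simp
  then show ?case using assms(1) by simp
qed

lemma blk_poly_0_eq_code_sum:
  fixes t :: "'a::idom"
  assumes "t \<noteq> 1"
  shows "poly (blk_poly t c) 0 = code_sum t c"
proof (rule convolution_identity_unique[OF assms])
  fix c
  show "(\<Sum>e\<in>subvecs c. poly (blk_poly t (vec_diff c e)) 0 * (t ^ sum_list e - t)) = 1 - t"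
    using arg_cong[OF blk_poly_identity[of t c], of "\<lambda>p. poly p 0"] by (simp add: poly_sum)
qed (rule code_sum_identity)

section \<open>The theorem\<close>

lemma qt_eq_power: "qt a b = monom (monom 1 1) 0 ^ a * monom 1 1 ^ b"
  by (simp add: qt_def monom_power mult_monom)

text \<open>Whether a word underlies a code, which functions \<open>f\<close> it admits and the
  value of \<open>ind\<close> depend only on the multiplicities of its letters. So the sum splits by
  content, and the factor arising from \<open>f\<close> is constant on each part.\<close>

lemma sum_Code_cong:
  fixes g g' :: "nat list \<Rightarrow> 'a::comm_ring_1"
  assumes eq: "\<And>M. (\<Sum>\<alpha>\<in>permutations_of_multiset M. g \<alpha>) = (\<Sum>\<alpha>\<in>permutations_of_multiset M. g' \<alpha>)"
  shows "(\<Sum>(\<alpha>, f)\<in>Code n. g \<alpha> * t ^ ind \<alpha> f) = (\<Sum>(\<alpha>, f)\<in>Code n. g' \<alpha> * t ^ ind \<alpha> f)"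
proof -
  define L where "L = fst ` Code n"
  define F where "F \<alpha> = (\<Pi>\<^sub>E k\<in>{1..max_letter \<alpha>}. {1..count_list \<alpha> k - 1})" for \<alpha>
  define h where "h \<alpha> = (\<Sum>f\<in>F \<alpha>. t ^ ind \<alpha> f)" for \<alpha>
  have Code: "Code n = Sigma L F"
  proof (intro subset_antisym subrelI)
    fix \<alpha> f assume "(\<alpha>, f) \<in> Code n"
    moreover from this have "\<alpha> \<in> L" unfolding L_def by (metis fst_conv image_eqI)
    ultimately show "(\<alpha>, f) \<in> Sigma L F" by (simp add: F_def Code_def)
  next
    fix \<alpha> f assume "(\<alpha>, f) \<in> Sigma L F"
    then have "\<alpha> \<in> L" and f: "f \<in> F \<alpha>" by auto
    then obtain f' where "(\<alpha>, f') \<in> Code n" unfolding L_def by auto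
    then show "(\<alpha>, f) \<in> Code n" using f by (simp add: F_def Code_def)
  qed
  have finL: "finite L" unfolding L_def by (intro finite_imageI finite_Code)
  have finF: "finite (F \<alpha>)" for \<alpha> unfolding F_def by (intro finite_PiE) auto
  have count: "count_list \<beta> k = count_list \<alpha> k" and max: "max_letter \<beta> = max_letter \<alpha>"
    if "mset \<beta> = mset \<alpha>" for \<alpha> \<beta> :: "nat list" and k
    using that mset_eq_setD[OF that] by (simp_all add: max_letter_def flip: count_mset)
  have inL: "\<beta> \<in> L" if "\<alpha> \<in> L" "mset \<beta> = mset \<alpha>" for \<alpha> \<beta>
  proof -
    from that(1) obtain f where "(\<alpha>, f) \<in> Code n" unfolding L_def by auto
    then have "(\<beta>, f) \<in> Code n"
      using count[OF that(2)] max[OF that(2)] mset_eq_length[OF that(2)] by (simp add: Code_def)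
    then show ?thesis unfolding L_def by (metis fst_conv image_eqI)
  qed
  have h: "h \<beta> = h \<alpha>" if "mset \<beta> = mset \<alpha>" for \<alpha> \<beta>
    using count[OF that] max[OF that] by (simp add: h_def F_def ind_def)
  \<comment> \<open>\<open>SOME\<close> picks any word of content \<open>M\<close>; the fact
    \<open>h\<close> makes the choice irrelevant.\<close>
  have "(\<Sum>(\<alpha>, f)\<in>Code n. u \<alpha> * t ^ ind \<alpha> f) =
      (\<Sum>M\<in>mset ` L. (\<Sum>\<alpha>\<in>permutations_of_multiset M. u \<alpha>) * h (SOME \<alpha>. mset \<alpha> = M))"
    for u :: "nat list \<Rightarrow> 'a"
  proof -
    have "(\<Sum>(\<alpha>, f)\<in>Code n. u \<alpha> * t ^ ind \<alpha> f) = (\<Sum>\<alpha>\<in>L. u \<alpha> * h \<alpha>)"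
      unfolding Code h_def sum_distrib_left
      by (rule sum.Sigma[symmetric]) (use finL finF in auto)
    also have "\<dots> = (\<Sum>M\<in>mset ` L. \<Sum>\<alpha> | \<alpha> \<in> L \<and> mset \<alpha> = M. u \<alpha> * h \<alpha>)"
      by (rule sum.group[symmetric]) (use finL in auto)
    also have "\<dots> = (\<Sum>M\<in>mset ` L. (\<Sum>\<alpha>\<in>permutations_of_multiset M. u \<alpha>) * h (SOME \<alpha>. mset \<alpha> = M))"
    proof (rule sum.cong[OF refl])
      fix M assume "M \<in> mset ` L"
      then have perms: "{\<alpha>. \<alpha> \<in> L \<and> mset \<alpha> = M} = permutations_of_multiset M"
        using inL by (auto simp: permutations_of_multiset_def)
      have some: "mset (SOME \<alpha>. mset \<alpha> = M) = M" by (rule someI_ex) (rule ex_mset)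
      show "(\<Sum>\<alpha> | \<alpha> \<in> L \<and> mset \<alpha> = M. u \<alpha> * h \<alpha>) =
          (\<Sum>\<alpha>\<in>permutations_of_multiset M. u \<alpha>) * h (SOME \<alpha>. mset \<alpha> = M)"
        unfolding perms sum_distrib_right
      proof (rule sum.cong[OF refl])
        fix \<alpha> assume "\<alpha> \<in> permutations_of_multiset M"
        then have "mset \<alpha> = mset (SOME \<alpha>. mset \<alpha> = M)" by (simp add: some permutations_of_multiset_def)
        from h[OF this] show "u \<alpha> * h \<alpha> = u \<alpha> * h (SOME \<alpha>. mset \<alpha> = M)" by simp
      qed
    qed
    finally show ?thesis .
  qed
  then show ?thesis by (simp add: eq)
qed

lemma sum_group_DES:
  fixes F :: "'a \<Rightarrow> 'b::comm_ring_1"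
  assumes "finite X" "finite \<S>" "\<And>x. x \<in> X \<Longrightarrow> D x \<in> \<S>"
  shows "(\<Sum>x\<in>X. q ^ \<Sum>(D x) * F x) = (\<Sum>S\<in>\<S>. q ^ \<Sum>S * (\<Sum>x | x \<in> X \<and> D x = S. F x))"
proof -
  have "(\<Sum>x\<in>X. q ^ \<Sum>(D x) * F x) = (\<Sum>S\<in>\<S>. \<Sum>x | x \<in> X \<and> D x = S. q ^ \<Sum>(D x) * F x)"
    by (rule sum.group[symmetric]) (use assms in auto)
  also have "\<dots> = (\<Sum>S\<in>\<S>. q ^ \<Sum>S * (\<Sum>x | x \<in> X \<and> D x = S. F x))"
    unfolding sum_distrib_left by (intro sum.cong) auto
  finally show ?thesis .
qed

text \<open>For the block sizes \<open>c\<close> cut out by \<open>S\<close>, the left side is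
  \<open>blk_poly t c\<close> at \<open>s = 0\<close> and the right side is
  \<open>code_sum t c\<close>.\<close>

lemma sum_exc_eq_sum_ind:
  fixes t :: "'a::idom"
  assumes "t \<noteq> 1" "S \<subseteq> {1..<n}"
  shows "(\<Sum>\<sigma> | \<sigma> permutes {1..n} \<and> DES (bar_word n \<sigma>) \<subseteq> S. t ^ exc n \<sigma>) =
    (\<Sum>p | p \<in> Code n \<and> DES (fst p) \<subseteq> S. t ^ ind (fst p) (snd p))"
proof -
  obtain c where c: "n = sum_list c" "\<And>w. length w = n \<Longrightarrow> bsorted c w \<longleftrightarrow> DES w \<subseteq> S"
    using ex_bsorted_iff_DES_subset[OF assms(2)] by auto
  have "(\<Sum>\<sigma> | \<sigma> permutes {1..n} \<and> DES (bar_word n \<sigma>) \<subseteq> S. t ^ exc n \<sigma>) =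
      (\<Sum>\<sigma> | \<sigma> permutes {1..n} \<and> bsorted c (bar_word n \<sigma>). t ^ exc n \<sigma>)"
    by (simp add: c(2))
  also have "\<dots> = code_sum t c"
    unfolding sum_exc_bsorted[OF c(1)] by (rule blk_poly_0_eq_code_sum[OF assms(1)])
  also have "sorted_codes c = {p. p \<in> Code n \<and> DES (fst p) \<subseteq> S}"
    unfolding sorted_codes_def c(1)[symmetric] using c(2) by (auto simp: Code_def)
  then have "code_sum t c = (\<Sum>p | p \<in> Code n \<and> DES (fst p) \<subseteq> S. t ^ ind (fst p) (snd p))"
    by (simp add: code_sum_def case_prod_unfold)
  finally show ?thesis .
qed

theorem theorem6p11:
  fixes n :: nat
  assumes "n \<ge> 1"
  shows "q_Eulerian n = (\<Sum>(\<alpha>, f)\<in>Code n. qt (inv_num \<alpha>) (ind \<alpha> f)) \<and>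
         (\<Sum>(\<alpha>, f)\<in>Code n. qt (inv_num \<alpha>) (ind \<alpha> f)) = (\<Sum>(\<alpha>, f)\<in>Code n. qt (maj \<alpha>) (ind \<alpha> f))"
proof -
  define q t :: "int poly poly" where "q = monom (monom 1 1) 0" and "t = monom 1 1"
  have qt: "qt a b = q ^ a * t ^ b" for a b by (simp add: qt_eq_power q_def t_def)
  \<comment> \<open>\<open>q\<close> is an indeterminate: the coefficient of its \<open>i\<close>-th
    power distinguishes \<open>q ^ i\<close> from 1.\<close>
  have q: "q ^ i \<noteq> 1" if "i > 0" for i
  proof
    assume "q ^ i = 1"
    moreover have "coeff (coeff (q ^ i) 0) i = 1" by (simp add: q_def monom_power)
    moreover have "coeff (coeff (1 :: int poly poly) 0) i = 0" using that by simp
    ultimately show False by simp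
  qed
  have t: "t \<noteq> 1"
  proof
    assume "t = 1"
    then have "coeff t 0 = 1" by simp
    then show False by (simp add: t_def)
  qed
  have inv_maj: "(\<Sum>(\<alpha>, f)\<in>Code n. qt (inv_num \<alpha>) (ind \<alpha> f)) = (\<Sum>(\<alpha>, f)\<in>Code n. qt (maj \<alpha>) (ind \<alpha> f))"
    unfolding qt by (rule sum_Code_cong) (rule maj_inv_equidistributed[OF q, symmetric])
  let ?P = "{\<sigma>. \<sigma> permutes {1..n}}" and ?D = "\<lambda>\<sigma>. DES (bar_word n \<sigma>)"
  have fin: "finite ?P" by (rule finite_permutations) simp
  \<comment> \<open>Subset inversion passes from descent sets contained in \<open>S'\<close>, for
    all \<open>S' \<subseteq> S\<close>, to descent sets equal to \<open>S\<close>. Grouping by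
    descent set then yields the formula with \<open>maj\<close>.\<close>
  have sums: "(\<Sum>\<sigma> | \<sigma> \<in> ?P \<and> ?D \<sigma> = S. t ^ exc n \<sigma>) =
      (\<Sum>p | p \<in> Code n \<and> DES (fst p) = S. t ^ ind (fst p) (snd p))" if "S \<in> Pow {1..<n}" for S
  proof (rule sum_by_subset_inversion[OF fin finite_Code])
    show "finite S" using that finite_subset by blast
    show "(\<Sum>\<sigma> | \<sigma> \<in> ?P \<and> ?D \<sigma> \<subseteq> S'. t ^ exc n \<sigma>) =
        (\<Sum>p | p \<in> Code n \<and> DES (fst p) \<subseteq> S'. t ^ ind (fst p) (snd p))" if "S' \<subseteq> S" for S'
      using sum_exc_eq_sum_ind[OF t, of S' n] that \<open>S \<in> Pow {1..<n}\<close> by auto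
  qed
  have "q_Eulerian n = (\<Sum>\<sigma>\<in>?P. q ^ \<Sum>(?D \<sigma>) * t ^ exc n \<sigma>)"
    unfolding q_Eulerian_def qt by (rule sum.cong) (simp_all add: maj_eq_bar_word)
  also have "\<dots> = (\<Sum>S\<in>Pow {1..<n}. q ^ \<Sum>S * (\<Sum>\<sigma> | \<sigma> \<in> ?P \<and> ?D \<sigma> = S. t ^ exc n \<sigma>))"
    by (rule sum_group_DES) (use fin DES_subset[of "bar_word n _"] in auto)
  also have "\<dots> = (\<Sum>S\<in>Pow {1..<n}. q ^ \<Sum>S * (\<Sum>p | p \<in> Code n \<and> DES (fst p) = S. t ^ ind (fst p) (snd p)))"
    by (rule sum.cong[OF refl]) (simp only: sums)
  also have "\<dots> = (\<Sum>p\<in>Code n. q ^ \<Sum>(DES (fst p)) * t ^ ind (fst p) (snd p))"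
  proof (rule sum_group_DES[symmetric])
    fix p assume "p \<in> Code n"
    then have "length (fst p) = n" by (auto simp: Code_def)
    then show "DES (fst p) \<in> Pow {1..<n}" using DES_subset[of "fst p"] by simp
  qed (simp_all add: finite_Code)
  also have "\<dots> = (\<Sum>(\<alpha>, f)\<in>Code n. qt (maj \<alpha>) (ind \<alpha> f))"
    by (simp add: qt maj_def case_prod_unfold)
  finally show ?thesis using inv_maj by simp
qed

end
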